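(* Let $K$ be a field of characteristic $p>0$ such that $K/K^{p^\infty}$ is a finitely generated field extension, where $K^{p^\infty}=\bigcap_{n\ge 0}K^{p^n}$. There is a bijection between power towers on $K$ and Jacobson sequences on $K$, given by $W_\bullet\mapsto(T_{W_0/W_1},T_{W_1/W_2},\ldots)$ with inverse $(\mathcal{F}_1,\mathcal{F}_2,\ldots)\mapsto(W_n)_{n\ge0}$, $W_0=K$, $W_n=\operatorname{Ann}(\mathcal{F}_n)$ for $n\ge1$. For every integer $n\ge 0$ this bijection restricts to a bijection between power towers of length at most $n$ and Jacobson sequences of length at most $n$. Moreover, for $m\ge 1$, $\dim_{W_m}(W_{m-1})=p^{\dim_{W_{m-1}}(\mathcal{F}_m)}$.
   Context: A power tower on $K$ is a sequence of subfields $W_0,W_1,\ldots$ of $K$ with $W_j=W_i\cdot K^{p^j}$ whenever $j\le i$ ($\cdot$ = compositum in $K$); it has length at most $n$ if $W_N=W_n$ for all $N\ge n$. For a field $F$ of characteristic $p$, $TF$ is the space of derivations of $F$ and $T_{F/A}$ the derivations vanishing on a subfield $A$. A $p$-Lie algebra on $F$ is an $F$-subspace of $TF$ closed under commutators and $p$-th powers (of composition); $\operatorname{Ann}(L)=\{x\in F:D(x)=0\ \forall D\in L\}$. A Jacobson sequence on $K$ is a sequence $(\mathcal{F}_1,\mathcal{F}_2,\ldots)$ where $\mathcal{F}_1$ is a $p$-Lie algebra on $K$ and $\mathcal{F}_{i+1}$ is a $p$-Lie algebra on $\operatorname{Ann}(\mathcal{F}_i)$ with $\mathcal{F}_{i+1}\cap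 T_{\operatorname{Ann}(\mathcal{F}_i)/K^{p^i}}=0$; it has length at most $n$ if $\mathcal{F}_N=0$ for all $N>n$. *)

theory Defs
  imports Main "HOL-Library.Function_Algebras" "HOL-Computational_Algebra.Primes"
begin

text \<open>The ambient field K is the whole type 'a (of class field); subfields of K are sets.\<close>

definition is_subfield :: "'a::field set \<Rightarrow> bool" where
  "is_subfield A \<longleftrightarrow> 0 \<in> A \<and> 1 \<in> A \<and>
     (\<forall>x\<in>A. \<forall>y\<in>A. x + y \<in> A \<and> x - y \<in> A \<and> x * y \<in> A) \<and>
     (\<forall>x\<in>A. inverse x \<in> A)"

definition gen_field :: "'a::field set \<Rightarrow> 'a set" where
  "gen_field X = \<Inter>{A. is_subfield A \<and> X \<subseteq> A}"

definition compositum :: "'a::field set \<Rightarrow> 'a set \<Rightarrow> 'a set" where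
  "compositum A B = gen_field (A \<union> B)"

definition pow_field :: "nat \<Rightarrow> nat \<Rightarrow> 'a::field set" where
  "pow_field p j = {x ^ (p ^ j) | x. True}"

definition pinf_field :: "nat \<Rightarrow> 'a::field set" where
  "pinf_field p = (\<Inter>n. pow_field p n)"

definition fin_gen_ext :: "'a::field set \<Rightarrow> bool" where
  "fin_gen_ext A \<longleftrightarrow> (\<exists>S. finite S \<and> gen_field (A \<union> S) = UNIV)"

text \<open>Derivations of a subfield F, represented extensionally (zero outside F).\<close>
definition der :: "'a::field set \<Rightarrow> ('a \<Rightarrow> 'a) set" where
  "der F = {D. (\<forall>x\<in>F. D x \<in> F) \<and> (\<forall>x. x \<notin> F \<longrightarrow> D x = 0) \<and>
              (\<forall>x\<in>F. \<forall>y\<in>F. D (x + y) = D x + D y \<and> D (x * y) = x * D y + y * D x)}"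

definition relder :: "'a::field set \<Rightarrow> 'a set \<Rightarrow> ('a \<Rightarrow> 'a) set" where
  "relder F A = {D \<in> der F. \<forall>a\<in>A. D a = 0}"

definition p_lie :: "nat \<Rightarrow> 'a::field set \<Rightarrow> ('a \<Rightarrow> 'a) set \<Rightarrow> bool" where
  "p_lie p F L \<longleftrightarrow> L \<subseteq> der F \<and> (\<lambda>_. 0) \<in> L \<and>
     (\<forall>D\<in>L. \<forall>E\<in>L. (\<lambda>x. D x + E x) \<in> L) \<and>
     (\<forall>c\<in>F. \<forall>D\<in>L. (\<lambda>x. c * D x) \<in> L) \<and>
     (\<forall>D\<in>L. \<forall>E\<in>L. (\<lambda>x. D (E x) - E (D x)) \<in> L) \<and>
     (\<forall>D\<in>L. (D ^^ p) \<in> L)"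

definition Ann :: "'a::field set \<Rightarrow> ('a \<Rightarrow> 'a) set \<Rightarrow> 'a set" where
  "Ann F L = {x \<in> F. \<forall>D\<in>L. D x = 0}"

definition power_tower :: "nat \<Rightarrow> (nat \<Rightarrow> 'a::field set) \<Rightarrow> bool" where
  "power_tower p W \<longleftrightarrow> (\<forall>i. is_subfield (W i)) \<and>
     (\<forall>i j. j \<le> i \<longrightarrow> W j = compositum (W i) (pow_field p j))"

definition tower_len_le :: "(nat \<Rightarrow> 'a set) \<Rightarrow> nat \<Rightarrow> bool" where
  "tower_len_le W n \<longleftrightarrow> (\<forall>N\<ge>n. W N = W n)"

text \<open>Jacobson sequences (F_1, F_2, ...) are encoded as F :: nat => ..., with the
  unused index 0 fixed to the zero space {0}. annseq F i = Ann(F_i), annseq F 0 = K.\<close>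
fun annseq :: "(nat \<Rightarrow> ('a::field \<Rightarrow> 'a) set) \<Rightarrow> nat \<Rightarrow> 'a set" where
  "annseq F 0 = UNIV"
| "annseq F (Suc i) = Ann (annseq F i) (F (Suc i))"

definition jacobson_seq :: "nat \<Rightarrow> (nat \<Rightarrow> ('a::field \<Rightarrow> 'a) set) \<Rightarrow> bool" where
  "jacobson_seq p F \<longleftrightarrow> F 0 = {\<lambda>_. 0} \<and> p_lie p UNIV (F 1) \<and>
     (\<forall>i\<ge>1. p_lie p (annseq F i) (F (Suc i)) \<and>
             F (Suc i) \<inter> relder (annseq F i) (pow_field p i) = {\<lambda>_. 0})"

definition jac_len_le :: "(nat \<Rightarrow> ('a::field \<Rightarrow> 'a) set) \<Rightarrow> nat \<Rightarrow> bool" where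
  "jac_len_le F n \<longleftrightarrow> (\<forall>N>n. F N = {\<lambda>_. 0})"

definition to_jac :: "(nat \<Rightarrow> 'a::field set) \<Rightarrow> nat \<Rightarrow> ('a \<Rightarrow> 'a) set" where
  "to_jac W i = (if i = 0 then {\<lambda>_. 0} else relder (W (i - 1)) (W i))"

definition to_tower :: "(nat \<Rightarrow> ('a::field \<Rightarrow> 'a) set) \<Rightarrow> nat \<Rightarrow> 'a set" where
  "to_tower F = annseq F"

definition has_dim :: "('s::zero \<Rightarrow> 'v \<Rightarrow> 'v::comm_monoid_add) \<Rightarrow> 's set \<Rightarrow> 'v set \<Rightarrow> nat \<Rightarrow> bool" where
  "has_dim sc S V n \<longleftrightarrow> (\<exists>B. finite B \<and> card B = n \<and> B \<subseteq> V \<and>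
     V = {\<Sum>b\<in>B. sc (c b) b | c. \<forall>b\<in>B. c b \<in> S} \<and>
     (\<forall>c. (\<forall>b\<in>B. c b \<in> S) \<and> (\<Sum>b\<in>B. sc (c b) b) = 0 \<longrightarrow> (\<forall>b\<in>B. c b = 0)))"

end

theory Submission
  imports Defs "HOL-Computational_Algebra.Polynomial"
begin

text \<open>Everything reduces to Jacobson's correspondence in exponent one, for a subfield \<open>F\<close>
  finitely generated over \<open>F\<^sup>p\<close>: the fields between \<open>F\<^sup>p\<close> and \<open>F\<close> correspond to the \<open>p\<close>-Lie algebras
  on \<open>F\<close> via \<open>E \<mapsto> T\<^bsub>F/E\<^esub>\<close> and \<open>L \<mapsto> Ann L\<close>. For a Jacobson sequence, a derivation of \<open>W\<^sub>i\<close> killing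
  \<open>W\<^bsub>i+1\<^esub> \<cdot> K\<^bsup>p^i\<^esup>\<close> lies in \<open>\<F>\<^bsub>i+1\<^esub> \<inter> T\<^bsub>W_i/K^(p^i)\<^esub> = 0\<close>, so the correspondence
  gives \<open>W\<^bsub>i+1\<^esub> \<cdot> K\<^bsup>p^i\<^esup> = W\<^sub>i\<close>; the general tower condition follows by iterating.\<close>

section \<open>Subfields\<close>

text \<open>The hypothesis on \<open>K\<close> enters only as a dimension bound: \<open>K\<close> is
  finite-dimensional over each \<open>K ^ (p ^ (i + 1))\<close>, and a field \<open>W\<close>
  containing \<open>K ^ (p ^ i)\<close> is a subspace of \<open>K\<close> over these scalars, which
  themselves lie among the p-th powers of \<open>W\<close>. Both kinds of sequence satisfy the
  containment at level \<open>i\<close>, so every level is an exponent-one situation with finitely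
  many generators. The two halves of the correspondence differ in nature.
  \<open>Ann F (relder F E) = E\<close> needs enough derivations: each element outside
  \<open>E\<close> must be moved by one, which is built by adjoining that element and then the
  generators; finiteness makes this an ordinary induction. \<open>relder F (Ann F L) = L\<close>
  needs that there are not too many: after subtraction of the element of \<open>L\<close> with the
  same values on finitely many test elements, the rest must vanish on all of \<open>F\<close>. This
  is shown by climbing from \<open>Ann F L\<close> to \<open>F\<close> through fields of constants.
  The same chain computes the degree, so the dimension formula comes from the same
  construction.\<close>

lemma subfield_0: "is_subfield A \<Longrightarrow> 0 \<in> A"
  and subfield_1: "is_subfield A \<Longrightarrow> 1 \<in> A"
  and subfield_add: "is_subfield A \<Longrightarrow> x \<in> A \<Longrightarrow> y \<in> A \<Longrightarrow> x + y \<in> A"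
  and subfield_diff: "is_subfield A \<Longrightarrow> x \<in> A \<Longrightarrow> y \<in> A \<Longrightarrow> x - y \<in> A"
  and subfield_mult: "is_subfield A \<Longrightarrow> x \<in> A \<Longrightarrow> y \<in> A \<Longrightarrow> x * y \<in> A"
  and subfield_inverse: "is_subfield A \<Longrightarrow> x \<in> A \<Longrightarrow> inverse x \<in> A"
  unfolding is_subfield_def by blast+

lemma subfield_minus: "is_subfield A \<Longrightarrow> x \<in> A \<Longrightarrow> - x \<in> A"
  using subfield_diff[of A 0 x] by (simp add: subfield_0)

lemma subfield_power: "is_subfield A \<Longrightarrow> x \<in> A \<Longrightarrow> x ^ n \<in> A"
  by (induction n) (auto intro: subfield_1 subfield_mult)

lemma subfield_sum: "is_subfield A \<Longrightarrow> (\<And>i. i \<in> I \<Longrightarrow> f i \<in> A) \<Longrightarrow> sum f I \<in> A"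
  by (induction I rule: infinite_finite_induct) (auto intro: subfield_0 subfield_add)

lemma subfield_of_nat: "is_subfield A \<Longrightarrow> of_nat n \<in> A"
  by (induction n) (auto intro: subfield_0 subfield_1 subfield_add)

lemmas subfield_closed = subfield_0 subfield_1 subfield_add subfield_diff subfield_mult
  subfield_inverse subfield_minus subfield_power subfield_sum subfield_of_nat

lemma is_subfield_UNIV: "is_subfield UNIV"
  by (simp add: is_subfield_def)

lemma is_subfield_gen_field: "is_subfield (gen_field X)"
  unfolding gen_field_def is_subfield_def by blast

lemma gen_field_superset: "X \<subseteq> gen_field X"
  unfolding gen_field_def by blast

lemma gen_field_least: "is_subfield A \<Longrightarrow> X \<subseteq> A \<Longrightarrow> gen_field X \<subseteq> A"
  unfolding gen_field_def by blast

lemma gen_field_mono: "X \<subseteq> Y \<Longrightarrow> gen_field X \<subseteq> gen_field Y"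
  by (meson gen_field_least gen_field_superset is_subfield_gen_field order_trans)

lemma gen_field_absorb: "Y \<subseteq> gen_field X \<Longrightarrow> gen_field (Y \<union> X) = gen_field X"
  by (meson Un_least Un_upper2 gen_field_least gen_field_mono gen_field_superset
      is_subfield_gen_field subset_antisym)

lemma gen_field_gen_field: "gen_field (gen_field X \<union> Y) = gen_field (X \<union> Y)"
proof
  have "gen_field X \<subseteq> gen_field (X \<union> Y)" "Y \<subseteq> gen_field (X \<union> Y)"
    using gen_field_mono[of X "X \<union> Y"] gen_field_superset[of "X \<union> Y"] by auto
  then show "gen_field (gen_field X \<union> Y) \<subseteq> gen_field (X \<union> Y)"
    by (simp add: gen_field_least is_subfield_gen_field)
  show "gen_field (X \<union> Y) \<subseteq> gen_field (gen_field X \<union> Y)"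
    using gen_field_superset[of X] by (intro gen_field_mono) auto
qed

text \<open>In characteristic \<open>p\<close> raising to the power \<open>p ^ j\<close> is
  additive, so this set is the image of a field homomorphism.\<close>

lemma is_subfield_pow_field:
  assumes "prime p" "CHAR('a::field) = p"
  shows "is_subfield (pow_field p j :: 'a set)"
proof -
  have add: "(x + y) ^ (p ^ j) = x ^ (p ^ j) + y ^ (p ^ j)" for x y :: 'a
    using freshmans_dream'[of "p ^ j" j x y] assms by simp
  have diff: "(x - y) ^ (p ^ j) = x ^ (p ^ j) - y ^ (p ^ j)" for x y :: 'a
    using add[of "x - y" y] by (simp add: algebra_simps)
  have "0 < p" using assms prime_gt_0_nat by blast
  then have "0 = (0::'a) ^ (p ^ j)" "1 = (1::'a) ^ (p ^ j)" by auto
  then have "0 \<in> (pow_field p j :: 'a set)" "1 \<in> (pow_field p j :: 'a set)"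
    unfolding pow_field_def by blast+
  then show ?thesis
    unfolding is_subfield_def
    by (auto simp: pow_field_def simp flip: add diff power_mult_distrib power_inverse)
qed

lemma pow_field_Suc: "pow_field p (Suc i) = (\<lambda>x. x ^ p) ` pow_field p i"
  unfolding pow_field_def by (auto simp: power_mult mult.commute[of p] image_iff)

lemma pow_field_antimono: "i \<le> j \<Longrightarrow> pow_field p j \<subseteq> pow_field p i"
proof
  fix x :: 'a assume "i \<le> j" "x \<in> pow_field p j"
  then obtain y where "x = y ^ (p ^ j)" by (auto simp: pow_field_def)
  moreover have "p ^ j = p ^ (j - i) * p ^ i"
    using \<open>i \<le> j\<close> by (simp flip: power_add)
  ultimately show "x \<in> pow_field p i"
    by (auto simp: pow_field_def power_mult)
qed

section \<open>Derivations\<close>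

lemma der_closed: "D \<in> der F \<Longrightarrow> x \<in> F \<Longrightarrow> D x \<in> F"
  and der_outside: "D \<in> der F \<Longrightarrow> x \<notin> F \<Longrightarrow> D x = 0"
  and der_add: "D \<in> der F \<Longrightarrow> x \<in> F \<Longrightarrow> y \<in> F \<Longrightarrow> D (x + y) = D x + D y"
  and der_mult: "D \<in> der F \<Longrightarrow> x \<in> F \<Longrightarrow> y \<in> F \<Longrightarrow> D (x * y) = x * D y + y * D x"
  unfolding der_def by blast+

lemma der_0: "is_subfield F \<Longrightarrow> D \<in> der F \<Longrightarrow> D 0 = 0"
  using der_add[of D F 0 0] subfield_0[of F] by (metis add_0 add_cancel_right_right)

lemma der_1: "is_subfield F \<Longrightarrow> D \<in> der F \<Longrightarrow> D 1 = 0"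
  using der_mult[of D F 1 1] subfield_1[of F] by (metis add_cancel_right_right mult_1)

lemma der_diff:
  assumes "is_subfield F" "D \<in> der F" "x \<in> F" "y \<in> F"
  shows "D (x - y) = D x - D y"
  using der_add[of D F "x - y" y] assms by (simp add: subfield_diff)

lemma der_sum:
  assumes "is_subfield F" "D \<in> der F" "\<And>i. i \<in> I \<Longrightarrow> f i \<in> F"
  shows "D (sum f I) = (\<Sum>i\<in>I. D (f i))"
  using assms(3)
proof (induction I rule: infinite_finite_induct)
  case (insert i I)
  then show ?case
    using assms by (simp add: der_add subfield_sum)
qed (use assms der_0 in auto)

lemma der_power:
  assumes "is_subfield F" "D \<in> der F" "x \<in> F"
  shows "D (x ^ n) = of_nat n * x ^ (n - 1) * D x"
proof (induction n)
  case (Suc n)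
  have "D (x ^ Suc n) = x * D (x ^ n) + x ^ n * D x"
    using assms by (simp add: der_mult subfield_power)
  also have "\<dots> = of_nat (Suc n) * x ^ n * D x"
    unfolding Suc by (cases n) (auto simp: algebra_simps)
  finally show ?case by simp
qed (use assms der_1 in auto)

section \<open>Kernels and annihilators as subfields\<close>

lemma der_inverse_eq_0:
  assumes "is_subfield F" "D \<in> der F" "x \<in> F" "D x = 0"
  shows "D (inverse x) = 0"
proof (cases "x = 0")
  case False
  have "D (x * inverse x) = x * D (inverse x) + inverse x * D x"
    using assms by (intro der_mult) (auto intro: subfield_inverse)
  then show ?thesis using False assms der_1[of F D] by simp
qed (use assms der_0 in auto)

lemma is_subfield_kernel:
  assumes "is_subfield F" "D \<in> der F"
  shows "is_subfield {x \<in> F. D x = 0}"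
  using assms unfolding is_subfield_def[of "{x \<in> F. D x = 0}"]
  by (auto simp: der_0 der_1 der_add der_diff der_mult der_inverse_eq_0 intro: subfield_closed)

text \<open>The kernel is a subfield, so it contains the generated field once it contains the
  generators.\<close>

lemma der_eq_0_gen_field:
  assumes "is_subfield F" "D \<in> der F" "X \<subseteq> F" "\<And>x. x \<in> X \<Longrightarrow> D x = 0" "y \<in> gen_field X"
  shows "D y = 0"
  using gen_field_least[OF is_subfield_kernel[OF assms(1,2)], of X] assms by auto

lemma is_subfield_Inter:
  assumes "\<And>A. A \<in> S \<Longrightarrow> is_subfield A"
  shows "is_subfield (\<Inter>S)"
  unfolding is_subfield_def[of "\<Inter>S"] using assms by (auto intro: subfield_closed)

lemma is_subfield_Ann:
  assumes "is_subfield F" "L \<subseteq> der F"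
  shows "is_subfield (Ann F L)"
proof -
  \<comment> \<open>Inserting \<open>F\<close> keeps the family nonempty, so an empty
    \<open>L\<close> gives \<open>F\<close>.\<close>
  have eq: "Ann F L = \<Inter>(insert F ((\<lambda>D. {x \<in> F. D x = 0}) ` L))"
    by (auto simp: Ann_def)
  show ?thesis
    unfolding eq
  proof (rule is_subfield_Inter)
    fix A assume "A \<in> insert F ((\<lambda>D. {x \<in> F. D x = 0}) ` L)"
    then consider "A = F" | D where "D \<in> L" "A = {x \<in> F. D x = 0}" by auto
    then show "is_subfield A"
      using assms is_subfield_kernel by cases auto
  qed
qed

section \<open>Iterates of a derivation and closure under p-th powers\<close>

lemma der_funpow_closed: "D \<in> der F \<Longrightarrow> x \<in> F \<Longrightarrow> (D ^^ n) x \<in> F"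
  by (induction n) (auto intro: der_closed)

lemma der_funpow_add:
  "D \<in> der F \<Longrightarrow> x \<in> F \<Longrightarrow> y \<in> F \<Longrightarrow> (D ^^ n) (x + y) = (D ^^ n) x + (D ^^ n) y"
  by (induction n) (auto simp: der_add der_funpow_closed)

lemma der_funpow_0: "is_subfield F \<Longrightarrow> D \<in> der F \<Longrightarrow> (D ^^ n) 0 = 0"
  by (induction n) (auto simp: der_0)

lemma der_funpow_Leibniz:
  assumes F: "is_subfield F" "D \<in> der F" "x \<in> F" "y \<in> F"
  shows "(D ^^ n) (x * y) = (\<Sum>k\<le>n. of_nat (n choose k) * ((D ^^ k) x * (D ^^ (n - k)) y))"
proof (induction n)
  case (Suc n)
  let ?t = "\<lambda>i j. (D ^^ i) x * (D ^^ j) y"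
  have t: "?t i j \<in> F" for i j
    using F by (intro subfield_mult der_funpow_closed)
  have Dt: "D (of_nat m * ?t i j) = of_nat m * ?t (Suc i) j + of_nat m * ?t i (Suc j)" for i j m
  proof -
    have "D (of_nat m) = 0" by (induction m) (use F in \<open>auto simp: der_0 der_1 der_add subfield_closed\<close>)
    then have "D (of_nat m * ?t i j) = of_nat m * D (?t i j)"
      using F t by (simp add: der_mult subfield_of_nat)
    also have "D (?t i j) = ?t i (Suc j) + ?t (Suc i) j"
      using F by (simp add: der_mult der_funpow_closed mult.commute)
    finally show ?thesis by (simp add: algebra_simps)
  qed
  have "(D ^^ Suc n) (x * y) = D (\<Sum>k\<le>n. of_nat (n choose k) * ?t k (n - k))"
    using Suc by simp
  also have "\<dots> = (\<Sum>k\<le>n. D (of_nat (n choose k) * ?t k (n - k)))"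
    using F t by (intro der_sum) (auto intro: subfield_mult subfield_of_nat)
  also have "\<dots> = (\<Sum>k\<le>n. of_nat (n choose k) * ?t (Suc k) (n - k))
                + (\<Sum>k\<le>n. of_nat (n choose k) * ?t k (Suc n - k))"
    unfolding Dt sum.distrib by (simp add: Suc_diff_le)
  \<comment> \<open>The shifted sum may keep the upper bound \<open>n\<close>, since its last
    coefficient \<open>n choose Suc n\<close> is 0. Pascal's rule then merges the two sums.\<close>
  also have "(\<Sum>k\<le>n. of_nat (n choose k) * ?t k (Suc n - k))
      = ?t 0 (Suc n) + (\<Sum>k\<le>n. of_nat (n choose Suc k) * ?t (Suc k) (n - k))"
    using sum.atMost_Suc_shift[of "\<lambda>k. of_nat (n choose k) * ?t k (Suc n - k)" n]
    by (simp add: binomial_eq_0)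
  also have "(\<Sum>k\<le>n. of_nat (n choose k) * ?t (Suc k) (n - k)) + (?t 0 (Suc n) + (\<Sum>k\<le>n. of_nat (n choose Suc k) * ?t (Suc k) (n - k)))
     = ?t 0 (Suc n) + (\<Sum>k\<le>n. of_nat (Suc n choose Suc k) * ?t (Suc k) (n - k))"
    by (simp add: sum.distrib algebra_simps)
  also have "\<dots> = (\<Sum>k\<le>Suc n. of_nat (Suc n choose k) * ?t k (Suc n - k))"
    by (subst sum.atMost_Suc_shift) simp
  finally show ?case .
qed simp

text \<open>In the Leibniz rule for \<open>D ^^ p\<close> the binomial coefficients with
  \<open>0 < k < p\<close> are divisible by \<open>p\<close>, so only the two end terms
  survive.\<close>

lemma der_funpow_CHAR:
  assumes p: "prime p" "CHAR('a::field) = p" and F: "is_subfield (F :: 'a set)" and D: "D \<in> der F"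
  shows "D ^^ p \<in> der F"
proof -
  have "(D ^^ p) (x * y) = x * (D ^^ p) y + y * (D ^^ p) x" if "x \<in> F" "y \<in> F" for x y
  proof -
    have "(D ^^ p) (x * y) = (\<Sum>k\<le>p. of_nat (p choose k) * ((D ^^ k) x * (D ^^ (p - k)) y))"
      using der_funpow_Leibniz[OF F D that] .
    also have "\<dots> = (\<Sum>k\<in>{0,p}. of_nat (p choose k) * ((D ^^ k) x * (D ^^ (p - k)) y))"
    proof (rule sum.mono_neutral_right)
      show "\<forall>k\<in>{..p} - {0, p}. of_nat (p choose k) * ((D ^^ k) x * (D ^^ (p - k)) y) = 0"
      proof
        fix k assume k: "k \<in> {..p} - {0, p}"
        have "p dvd (p choose k)"
          by (rule dvd_choose_prime) (use k p in auto)
        then have "of_nat (p choose k) = (0::'a)"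
          using p by (simp add: of_nat_eq_0_iff_char_dvd)
        then show "of_nat (p choose k) * ((D ^^ k) x * (D ^^ (p - k)) y) = 0" by simp
      qed
    qed auto
    finally show ?thesis using p(1) prime_gt_0_nat[of p] by (simp add: mult.commute)
  qed
  moreover have "(D ^^ p) x = 0" if "x \<notin> F" for x
  proof -
    \<comment> \<open>The encoding demands the value 0 outside \<open>F\<close>; the innermost
      application of \<open>D\<close> supplies it, and there is one because
      \<open>p > 0\<close>.\<close>
    obtain q where "p = Suc q" using p(1) prime_gt_0_nat gr0_implies_Suc by blast
    then show ?thesis
      using that D F by (simp add: funpow_Suc_right der_outside der_funpow_0 del: funpow.simps)
  qed
  ultimately show ?thesis
    using der_funpow_closed[OF D] der_funpow_add[OF D] unfolding der_def[of F] by auto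
qed

text \<open>Serves twice: it makes \<open>to_jac W\<close> a sequence of p-Lie algebras, and it
  allows elements of \<open>L\<close> to be subtracted inside
  \<open>relder F (Ann F L)\<close>.\<close>

lemma p_lie_relder:
  assumes p: "prime p" "CHAR('a::field) = p" and F: "is_subfield (F :: 'a set)"
  shows "p_lie p F (relder F A)"
proof -
  have comm: "(\<lambda>x. D (E x) - E (D x)) \<in> der F" if D: "D \<in> der F" and E: "E \<in> der F" for D E
    unfolding der_def mem_Collect_eq
  proof (intro conjI ballI allI impI)
    fix x y assume "x \<in> F" "y \<in> F"
    then show "D (E (x + y)) - E (D (x + y)) = D (E x) - E (D x) + (D (E y) - E (D y))"
      using D E by (simp add: der_add der_closed)
    show "D (E (x * y)) - E (D (x * y)) = x * (D (E y) - E (D y)) + y * (D (E x) - E (D x))"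
      using D E F \<open>x \<in> F\<close> \<open>y \<in> F\<close>
      by (simp add: der_mult der_add der_closed subfield_mult algebra_simps)
  qed (use D E F in \<open>auto simp: der_outside der_0 der_closed subfield_diff\<close>)
  have "D ^^ p \<in> relder F A" if D: "D \<in> relder F A" for D
  proof -
    obtain q where "p = Suc q" using p(1) prime_gt_0_nat gr0_implies_Suc by blast
    then have "(D ^^ p) a = 0" if "a \<in> A" for a
      using that D F by (simp add: relder_def funpow_Suc_right der_funpow_0 del: funpow.simps)
    then show ?thesis
      using D der_funpow_CHAR[OF p F] by (simp add: relder_def)
  qed
  moreover have "(\<lambda>_. 0) \<in> der F"
    using F by (auto simp: der_def subfield_0)
  moreover have "(\<lambda>x. D x + E x) \<in> der F" if "D \<in> der F" "E \<in> der F" for D E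
    using that F by (auto simp: der_def subfield_add algebra_simps)
  moreover have "(\<lambda>x. c * D x) \<in> der F" if "c \<in> F" "D \<in> der F" for c D
    using that F by (auto simp: der_def subfield_mult algebra_simps)
  ultimately show ?thesis
    using comm F unfolding p_lie_def by (auto simp: relder_def der_0)
qed

section \<open>Adjoining a p-radical element and extending derivations\<close>

text \<open>Subfields are sets, not types, so polynomials live over the whole field and the location
  of their coefficients is tracked by a predicate.\<close>

definition over :: "'a::field set \<Rightarrow> 'a poly \<Rightarrow> bool" where
  "over M f \<longleftrightarrow> (\<forall>i. coeff f i \<in> M)"

text \<open>The ring \<open>M[x]\<close>; for p-radical \<open>x\<close> it is already the field
  \<open>M(x)\<close>, so no quotients are needed.\<close>

definition poly_adjoin :: "'a::field set \<Rightarrow> 'a \<Rightarrow> 'a set" where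
  "poly_adjoin M x = {poly f x | f. over M f}"

context
  fixes M :: "'a::field set"
  assumes M: "is_subfield M"
begin

lemma over_0: "over M 0"
  using M by (simp add: over_def subfield_0)

lemma over_pCons: "over M (pCons c f) \<longleftrightarrow> c \<in> M \<and> over M f"
  unfolding over_def by (metis coeff_pCons_0 coeff_pCons_Suc not0_implies_Suc)

lemma over_const: "c \<in> M \<Longrightarrow> over M [:c:]"
  by (simp add: over_pCons over_0)

lemma over_add: "over M f \<Longrightarrow> over M g \<Longrightarrow> over M (f + g)"
  and over_diff: "over M f \<Longrightarrow> over M g \<Longrightarrow> over M (f - g)"
  and over_smult: "c \<in> M \<Longrightarrow> over M f \<Longrightarrow> over M (smult c f)"
  and over_mult: "over M f \<Longrightarrow> over M g \<Longrightarrow> over M (f * g)"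
  using M by (simp_all add: over_def subfield_add subfield_diff subfield_mult subfield_sum coeff_mult)

lemma over_monom: "c \<in> M \<Longrightarrow> over M (monom c n)"
  using M by (simp add: over_def subfield_0)

lemma over_pderiv: "over M f \<Longrightarrow> over M (pderiv f)"
  using M by (auto simp: over_def coeff_pderiv simp del: of_nat_Suc intro!: subfield_mult subfield_of_nat)

lemma over_map_poly: "D 0 = 0 \<Longrightarrow> (\<And>a. a \<in> M \<Longrightarrow> D a \<in> M) \<Longrightarrow> over M f \<Longrightarrow> over M (map_poly D f)"
  by (simp add: over_def coeff_map_poly)

lemma poly_adjoin_superset: "insert x M \<subseteq> poly_adjoin M x"
proof -
  have "x = poly [:0, 1:] x" "over M [:0, 1:]"
    using M by (simp_all add: over_pCons over_0 subfield_0 subfield_1)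
  moreover have "c = poly [:c:] x" for c by simp
  ultimately show ?thesis
    unfolding poly_adjoin_def using over_const by blast
qed

lemma poly_in_subfield:
  assumes "is_subfield N" "insert x M \<subseteq> N" "over M f"
  shows "poly f x \<in> N"
  using assms(3)
proof (induction f)
  case (pCons c f)
  then show ?case
    using assms(1,2) by (auto simp: over_pCons intro: subfield_add subfield_mult)
qed (use assms subfield_0 in auto)

text \<open>Every \<open>u\<close> in \<open>M[x]\<close> has \<open>u ^ (p ^ n)\<close> in
  \<open>M\<close>, so \<open>inverse u\<close> is the power \<open>u ^ (p ^ n - 1)\<close> times
  the inverse of an element of \<open>M\<close>.\<close>

lemma is_subfield_poly_adjoin:
  assumes p: "prime p" "CHAR('a) = p" and x: "x ^ (p ^ n) \<in> M"
  shows "is_subfield (poly_adjoin M x)"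
proof -
  have frob: "poly f x ^ (p ^ n) \<in> M" if "over M f" for f
    using that
  proof (induction f)
    case (pCons c f)
    have "poly (pCons c f) x ^ (p ^ n) = c ^ (p ^ n) + x ^ (p ^ n) * poly f x ^ (p ^ n)"
      using p freshmans_dream'[of "p ^ n" n c "x * poly f x"] by (simp add: power_mult_distrib)
    then show ?case
      using pCons x M by (auto simp: over_pCons intro!: subfield_add subfield_mult subfield_power)
  qed (use M p(1) prime_gt_0_nat in \<open>auto simp: subfield_0 zero_power\<close>)
  have mult: "u * v \<in> poly_adjoin M x" if "u \<in> poly_adjoin M x" "v \<in> poly_adjoin M x" for u v
    using that over_mult unfolding poly_adjoin_def by (auto simp flip: poly_mult)
  have M_sub: "M \<subseteq> poly_adjoin M x"
    using poly_adjoin_superset by blast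
  have inv: "inverse u \<in> poly_adjoin M x" if u: "u \<in> poly_adjoin M x" for u
  proof (cases "u = 0")
    case False
    have pow: "u ^ k \<in> poly_adjoin M x" for k
      using M_sub M subfield_1 by (induction k) (auto intro: mult u)
    have "inverse (u ^ (p ^ n)) \<in> poly_adjoin M x"
      using u frob M_sub M by (auto simp: poly_adjoin_def intro!: subfield_inverse)
    moreover have "inverse u = u ^ (p ^ n - 1) * inverse (u ^ (p ^ n))"
    proof -
      have "0 < p ^ n" using p(1) prime_gt_0_nat by simp
      then have "u ^ (p ^ n) = u * u ^ (p ^ n - 1)"
        by (metis Suc_diff_1 power_Suc)
      then show ?thesis using False by (simp add: field_simps)
    qed
    ultimately show ?thesis using pow mult by metis
  qed (use u in simp)
  have "u + v \<in> poly_adjoin M x \<and> u - v \<in> poly_adjoin M x"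
    if "u \<in> poly_adjoin M x" "v \<in> poly_adjoin M x" for u v
    using that over_add over_diff unfolding poly_adjoin_def
    by (auto simp flip: poly_add poly_diff)
  then show ?thesis
    using mult inv M_sub M unfolding is_subfield_def[of "poly_adjoin M x"]
    by (auto dest: subfield_0 subfield_1)
qed

lemma gen_field_insert_eq:
  assumes "prime p" "CHAR('a) = p" "x ^ (p ^ n) \<in> M"
  shows "gen_field (insert x M) = poly_adjoin M x"
proof
  show "gen_field (insert x M) \<subseteq> poly_adjoin M x"
    using is_subfield_poly_adjoin[OF assms] poly_adjoin_superset by (intro gen_field_least)
  show "poly_adjoin M x \<subseteq> gen_field (insert x M)"
    using poly_in_subfield[OF is_subfield_gen_field gen_field_superset]
    by (auto simp: poly_adjoin_def)
qed

text \<open>Horner-style division: prepending a coefficient multiplies the old remainder by the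
  variable, and subtracting one multiple of \<open>g\<close> brings its degree back down. Since
  \<open>g\<close> is monic, no coefficient leaves \<open>M\<close>.\<close>

lemma division_by_monic:
  assumes g: "over M g" "lead_coeff g = 1" "degree g > 0" and f: "over M f"
  shows "\<exists>q r. over M q \<and> over M r \<and> f = q * g + r \<and> degree r < degree g"
  using f
proof (induction f)
  case 0
  then show ?case using g over_0 by (intro exI[of _ 0]) auto
next
  case (pCons c f)
  then obtain q r where qr: "over M q" "over M r" "f = q * g + r" "degree r < degree g"
    by (auto simp: over_pCons)
  \<comment> \<open>In \<open>pCons c r\<close> this coefficient sits in degree
    \<open>degree g\<close>, the only one to be cancelled.\<close>
  define b where "b = coeff r (degree g - 1)"
  define r' where "r' = pCons c r - smult b g"
  have "b \<in> M" using qr by (simp add: b_def over_def)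
  have "degree r' \<le> degree g"
    unfolding r'_def using qr(4) degree_smult_le[of b g]
    by (intro degree_diff_le) (auto intro: order_trans[OF degree_pCons_le])
  moreover have "coeff r' (degree g) = 0"
    using g(2,3) by (simp add: r'_def b_def coeff_pCons split: nat.splits)
  ultimately have "degree r' < degree g"
    using eq_zero_or_degree_less[of r' "degree g"] g(3) by auto
  moreover have "pCons c f = (pCons b q) * g + r'"
    unfolding r'_def qr(3) by (simp add: algebra_simps)
  moreover have "over M (pCons b q)" "over M r'"
    using qr pCons.prems \<open>b \<in> M\<close> g(1) unfolding r'_def
    by (auto simp: over_pCons intro!: over_diff over_smult)
  ultimately show ?case by blast
qed

end

text \<open>Evaluation at \<open>x\<close> shows that \<open>g\<close> or \<open>h\<close> has the
  root \<open>x\<close>; one linear factor is cancelled there and the exponent drops. This stands in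
  for unique factorisation.\<close>

lemma dvd_linear_power:
  fixes g :: "'a::field poly"
  assumes "g * h = [:- x, 1:] ^ n"
  shows "\<exists>c k. g = smult c ([:- x, 1:] ^ k)"
  using assms
proof (induction n arbitrary: g h)
  case 0
  then have "g dvd 1" by (metis dvd_triv_left power_0)
  then obtain c where "g = [:c:]" by (auto simp: is_unit_poly_iff)
  then have "g = smult c ([:- x, 1:] ^ 0)" by simp
  then show ?case by blast
next
  case (Suc n)
  have "poly g x * poly h x = 0"
    using arg_cong[OF Suc.prems, of "\<lambda>f. poly f x"] by simp
  then consider "poly g x = 0" | "poly h x = 0" by auto
  then show ?case
  proof cases
    case 1
    then obtain g' where g': "g = [:- x, 1:] * g'" by (auto simp: poly_eq_0_iff_dvd)
    then have "g' * h = [:- x, 1:] ^ n"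
      using Suc.prems by (simp add: mult.assoc del: mult_pCons_left mult_pCons_right)
    then obtain c k where "g' = smult c ([:- x, 1:] ^ k)" using Suc.IH by blast
    then have "g = smult c ([:- x, 1:] ^ Suc k)"
      using g' by (simp del: mult_pCons_left mult_pCons_right)
    then show ?thesis by blast
  next
    case 2
    then obtain h' where h': "h = [:- x, 1:] * h'" by (auto simp: poly_eq_0_iff_dvd)
    then have "[:- x, 1:] * (g * h') = [:- x, 1:] * [:- x, 1:] ^ n"
      using Suc.prems by (simp only: mult.left_commute[of g] power_Suc)
    then have "g * h' = [:- x, 1:] ^ n" by (subst (asm) mult_cancel_left) simp
    then show ?thesis using Suc.IH by blast
  qed
qed

text \<open>A proper monic factor \<open>(X - x) ^ d\<close> of \<open>X ^ p - x ^ p = (X - x) ^ p\<close> over \<open>M\<close>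
  would have the coefficient \<open>- d * x\<close> in \<open>M\<close>, with \<open>d\<close> invertible.\<close>

lemma no_small_annihilator:
  assumes p: "prime p" "CHAR('a::field) = p" and M: "is_subfield (M :: 'a set)"
    and x: "x \<notin> M" "x ^ p \<in> M"
    and f: "over M f" "poly f x = 0" "degree f < p"
  shows "f = 0"
proof (rule ccontr)
  assume "f \<noteq> 0"
  define P where "P d \<longleftrightarrow> (\<exists>f. over M f \<and> poly f x = 0 \<and> f \<noteq> 0 \<and> degree f = d)" for d
  define d where "d = (LEAST d. P d)"
  have "P (degree f)" using f \<open>f \<noteq> 0\<close> by (auto simp: P_def)
  then have "P d" "d \<le> degree f"
    unfolding d_def by (auto intro: LeastI Least_le)
  then obtain g0 where g0: "over M g0" "poly g0 x = 0" "g0 \<noteq> 0" "degree g0 = d"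
    by (auto simp: P_def)
  have minimal: "h = 0" if "over M h" "poly h x = 0" "degree h < d" for h
    using that not_less_Least[of "degree h" P] unfolding d_def[symmetric] by (auto simp: P_def)
  define g where "g = smult (inverse (lead_coeff g0)) g0"
  have g: "over M g" "poly g x = 0" "degree g = d" "lead_coeff g = 1"
    using g0 M by (auto simp: g_def over_def intro: subfield_mult subfield_inverse)
  have "d \<noteq> 0"
  proof
    assume "d = 0"
    then obtain c where "g = [:c:]" using g by (metis degree_0_id)
    then show False using g by auto
  qed
  define h where "h = [:- x, 1:] ^ p"
  have "p > 0" using p(1) prime_gt_0_nat by blast
  have h: "h = monom 1 p - [:x ^ p:]"
  proof -
    have "CHAR('a poly) = p" using p by simp
    then have "(monom 1 1 - [:x:] + [:x:]) ^ p = (monom 1 1 - [:x:]) ^ p + [:x:] ^ p"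
      by (intro freshmans_dream) (use p(1) in auto)
    then have "(monom 1 1 :: 'a poly) ^ p = (monom 1 1 - [:x:]) ^ p + [:x:] ^ p"
      by (simp only: diff_add_cancel)
    moreover have "monom 1 1 - [:x:] = [:- x, 1:]" by (simp add: monom_altdef)
    moreover have "(monom 1 1 :: 'a poly) ^ p = monom 1 p" by (simp add: monom_power)
    ultimately have "monom 1 p = [:- x, 1:] ^ p + [:x ^ p:]" by (simp only: poly_const_pow)
    then show ?thesis by (simp only: h_def add_diff_cancel_right')
  qed
  \<comment> \<open>Division of \<open>h\<close> by \<open>g\<close> leaves a remainder that
    vanishes at \<open>x\<close> and has degree below the minimum \<open>d\<close>, hence 0; so
    \<open>g\<close> divides \<open>h\<close>.\<close>
  have "over M h"
    unfolding h using M x by (intro over_diff over_monom over_const) (auto intro: subfield_1)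
  then obtain q r where qr: "over M r" "h = q * g + r" "degree r < d"
    using division_by_monic[OF M g(1), of h] g \<open>d \<noteq> 0\<close> by auto
  have "poly h x = 0" using \<open>p > 0\<close> by (simp add: h_def)
  then have "poly r x = 0" using qr g by simp
  then have "r = 0" using minimal qr by blast
  then have "g * q = [:- x, 1:] ^ p" using qr by (simp add: h_def mult.commute)
  then obtain c k where ck: "g = smult c ([:- x, 1:] ^ k)"
    using dvd_linear_power by blast
  have "c \<noteq> 0" using ck g by auto
  then have "k = d" using ck g(3) by (simp add: degree_linear_power)
  moreover have "c = 1"
    using ck g(4) \<open>c \<noteq> 0\<close> by (simp add: lead_coeff_power lead_coeff_smult)
  ultimately have "g = [:- x, 1:] ^ d" using ck by simp
  moreover have "d choose (d - 1) = d"
    using binomial_symmetric[of 1 d] \<open>d \<noteq> 0\<close> by simp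
  ultimately have "coeff g (d - 1) = of_nat d * - x"
    using \<open>d \<noteq> 0\<close> coeff_linear_poly_power[of "d - 1" d "- x" 1] by simp
  then have "of_nat d * - x \<in> M" using g(1) by (metis over_def)
  moreover have "of_nat d \<noteq> (0::'a)"
    using p \<open>d \<noteq> 0\<close> \<open>d \<le> degree f\<close> f(3) by (auto simp: of_nat_eq_0_iff_char_dvd dest: dvd_imp_le)
  ultimately have "inverse (of_nat d) * (of_nat d * - x) \<in> M"
    using M by (metis subfield_inverse subfield_mult subfield_of_nat)
  then have "- x \<in> M" using \<open>of_nat d \<noteq> (0::'a)\<close> by (simp add: mult.assoc[symmetric])
  then show False using x M subfield_minus by fastforce
qed

text \<open>The remainder modulo \<open>X ^ p - x ^ p\<close> still vanishes at \<open>x\<close> but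
  has degree below \<open>p\<close>, so it is 0. Thus \<open>X ^ p - x ^ p\<close> is the minimal
  polynomial of \<open>x\<close>, the only relation that an extension of a derivation must
  respect.\<close>

lemma poly_adjoin_annihilator:
  assumes p: "prime p" "CHAR('a::field) = p" and M: "is_subfield (M :: 'a set)"
    and x: "x \<notin> M" "x ^ p \<in> M" and f: "over M f" "poly f x = 0"
  shows "\<exists>q. over M q \<and> f = q * (monom 1 p - [:x ^ p:])"
proof -
  let ?h = "monom 1 p - [:x ^ p:]"
  have "p > 0" using p(1) prime_gt_0_nat by blast
  have "degree ?h = p"
  proof (rule antisym)
    show "degree ?h \<le> p" by (intro degree_diff_le) (auto simp: degree_monom_le)
    show "p \<le> degree ?h" using \<open>p > 0\<close> by (intro le_degree) (auto simp: coeff_pCons split: nat.splits)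
  qed
  moreover have "coeff ?h p = 1" using \<open>p > 0\<close> by (auto simp: coeff_pCons split: nat.splits)
  moreover have "over M ?h"
    using M x by (intro over_diff over_monom over_const) (auto intro: subfield_1)
  ultimately obtain q r where qr: "over M q" "over M r" "f = q * ?h + r" "degree r < p"
    using division_by_monic[OF M, of ?h f] f \<open>p > 0\<close> by auto
  then have "poly r x = 0" using f by (simp add: poly_monom)
  then have "r = 0" using no_small_annihilator[OF p M x] qr by blast
  then show ?thesis using qr by auto
qed

text \<open>The value at \<open>x\<close> can be prescribed freely: the relation
  \<open>X ^ p - x ^ p\<close> has coefficients killed by \<open>D\<close>, and its formal
  derivative is 0 in characteristic \<open>p\<close>.\<close>

lemma der_extend_adjoin:
  assumes p: "prime p" "CHAR('a::field) = p" and M: "is_subfield (M :: 'a set)"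
    and x: "x \<notin> M" "x ^ p \<in> M" and D: "D \<in> der M" "D (x ^ p) = 0"
    and v: "v \<in> poly_adjoin M x"
  shows "\<exists>D'\<in>der (poly_adjoin M x). (\<forall>y\<in>M. D' y = D y) \<and> D' x = v"
proof -
  let ?N = "poly_adjoin M x"
  have N: "is_subfield ?N" using is_subfield_poly_adjoin[OF M p, of x 1] x by simp
  have D0: "D 0 = 0" using der_0 D M by blast
  \<comment> \<open>The value that the Leibniz rule forces on \<open>poly f x\<close> once
    \<open>x\<close> is sent to \<open>v\<close>: \<open>D\<close> on the coefficients plus the
    chain-rule term.\<close>
  define \<delta> where "\<delta> f = poly (map_poly D f) x + poly (pderiv f) x * v" for f
  have \<delta>_add: "\<delta> (f + g) = \<delta> f + \<delta> g" if "over M f" "over M g" for f g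
  proof -
    have "map_poly D (f + g) = map_poly D f + map_poly D g"
      using that D by (intro poly_eqI) (simp add: coeff_map_poly D0 der_add over_def)
    then show ?thesis by (simp add: \<delta>_def pderiv_add algebra_simps)
  qed
  have \<delta>_mult: "\<delta> (f * g) = poly f x * \<delta> g + poly g x * \<delta> f" if fg: "over M f" "over M g" for f g
  proof -
    have "map_poly D (f * g) = f * map_poly D g + g * map_poly D f"
    proof (rule poly_eqI)
      fix n
      have "coeff (map_poly D (f * g)) n = D (\<Sum>i\<le>n. coeff f i * coeff g (n - i))"
        by (simp add: coeff_map_poly D0 coeff_mult)
      also have "\<dots> = (\<Sum>i\<le>n. D (coeff f i * coeff g (n - i)))"
        using fg M D by (intro der_sum) (auto simp: over_def intro: subfield_mult)
      also have "\<dots> = (\<Sum>i\<le>n. coeff f i * D (coeff g (n - i))) + (\<Sum>i\<le>n. D (coeff f i) * coeff g (n - i))"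
        using fg D by (simp add: der_mult over_def sum.distrib mult.commute)
      also have "\<dots> = coeff (f * map_poly D g + map_poly D f * g) n"
        by (simp add: coeff_map_poly D0 coeff_mult)
      finally show "coeff (map_poly D (f * g)) n = coeff (f * map_poly D g + g * map_poly D f) n"
        by (simp add: mult.commute)
    qed
    then show ?thesis by (simp add: \<delta>_def pderiv_mult algebra_simps)
  qed
  have \<delta>_0: "\<delta> f = 0" if f: "over M f" "poly f x = 0" for f
  proof -
    let ?h = "monom 1 p - [:x ^ p:]"
    obtain q where q: "over M q" "f = q * ?h"
      using poly_adjoin_annihilator[OF p M x f] by blast
    have "over M ?h"
      using M x by (intro over_diff over_monom over_const) (auto intro: subfield_1)
    moreover have "\<delta> ?h = 0"
    proof -
      have "D (coeff ?h i) = 0" for i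
        using D0 D(2) der_1[OF M D(1)] der_diff[OF M D(1), of 1 "x ^ p"] x M
          der_diff[OF M D(1), of 0 "x ^ p"]
        by (auto simp: coeff_pCons subfield_0 subfield_1 split: nat.splits)
      then have "map_poly D ?h = 0" by (intro poly_eqI) (simp add: coeff_map_poly D0)
      moreover have "of_nat p = (0::'a)" using p by (simp add: of_nat_eq_0_iff_char_dvd)
      then have "pderiv ?h = 0" by (simp add: pderiv_diff pderiv_monom pderiv_pCons)
      ultimately show ?thesis by (simp add: \<delta>_def)
    qed
    ultimately show ?thesis using \<delta>_mult q by (simp add: poly_monom)
  qed
  have \<delta>_eq: "\<delta> f = \<delta> g" if "over M f" "over M g" "poly f x = poly g x" for f g
  proof -
    have "\<delta> (g + (f - g)) = \<delta> g + \<delta> (f - g)" using that M by (intro \<delta>_add over_diff)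
    moreover have "\<delta> (f - g) = 0" using that M by (intro \<delta>_0 over_diff) auto
    ultimately show ?thesis by simp
  qed
  have \<delta>_closed: "\<delta> f \<in> ?N" if "over M f" for f
  proof -
    have "over M (map_poly D f)" "over M (pderiv f)"
      using that M D D0 by (auto intro!: over_map_poly over_pderiv intro: der_closed)
    then have "poly (map_poly D f) x \<in> ?N" "poly (pderiv f) x \<in> ?N"
      unfolding poly_adjoin_def by blast+
    then show ?thesis
      unfolding \<delta>_def using N v by (intro subfield_add subfield_mult)
  qed
  \<comment> \<open>By \<open>\<delta>_eq\<close> the choice of the polynomial does not
    matter.\<close>
  define D' where "D' y = (if y \<in> ?N then \<delta> (SOME f. over M f \<and> poly f x = y) else 0)" for y
  have D': "D' (poly f x) = \<delta> f" if f: "over M f" for f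
  proof -
    have "over M (SOME g. over M g \<and> poly g x = poly f x) \<and>
        poly (SOME g. over M g \<and> poly g x = poly f x) x = poly f x"
      by (rule someI[of _ f]) (use f in simp)
    then have "\<delta> (SOME g. over M g \<and> poly g x = poly f x) = \<delta> f"
      using \<delta>_eq f by blast
    moreover have "poly f x \<in> ?N" using f by (auto simp: poly_adjoin_def)
    ultimately show ?thesis unfolding D'_def by (simp only: if_True)
  qed
  have "D' \<in> der ?N"
    unfolding der_def mem_Collect_eq
  proof (intro conjI ballI allI impI)
    fix y z assume "y \<in> ?N" "z \<in> ?N"
    then obtain f g where fg: "over M f" "over M g" "y = poly f x" "z = poly g x"
      by (auto simp: poly_adjoin_def)
    show "D' (y + z) = D' y + D' z"
      using D'[of "f + g"] fg M by (simp add: D' \<delta>_add over_add)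
    show "D' (y * z) = y * D' z + z * D' y"
      using D'[of "f * g"] fg M by (simp add: D' \<delta>_mult over_mult)
    show "D' y \<in> ?N" using fg D' \<delta>_closed by simp
  qed (simp add: D'_def)
  moreover have "D' y = D y" if "y \<in> M" for y
    using D'[OF over_const[OF M that]] that by (simp add: \<delta>_def map_poly_pCons D0)
  moreover have "D' x = v"
  proof -
    have "over M [:0, 1:]" using M by (simp add: over_pCons over_0 subfield_0 subfield_1)
    then have "D' x = \<delta> [:0, 1:]" using D' by fastforce
    then show ?thesis using der_1[OF M D(1)] by (simp add: \<delta>_def map_poly_pCons D0 pderiv_pCons)
  qed
  ultimately show ?thesis by blast
qed

text \<open>Generators are adjoined one at a time, each sent to 0. Since \<open>s ^ p\<close> lies
  in \<open>E\<close>, where every intermediate extension vanishes, the condition of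
  \<open>der_extend_adjoin\<close> persists.\<close>

lemma der_extend_finite:
  assumes p: "prime p" "CHAR('a::field) = p"
    and S: "finite S" "\<And>s. s \<in> S \<Longrightarrow> s ^ p \<in> E"
    and M: "is_subfield (M :: 'a set)" "E \<subseteq> M" and D: "D \<in> relder M E"
  shows "\<exists>D'\<in>relder (gen_field (M \<union> S)) E. \<forall>y\<in>M. D' y = D y"
  using S M D
proof (induction S arbitrary: M D rule: finite_induct)
  case empty
  then have "gen_field M = M" by (meson gen_field_least gen_field_superset subset_antisym order_refl)
  then show ?case using empty by auto
next
  case (insert s S)
  show ?case
  proof (cases "s \<in> M")
    case True
    then have "M \<union> insert s S = M \<union> S" by auto
    then show ?thesis using insert by simp
  next
    case False
    let ?N = "poly_adjoin M s"
    have s: "s ^ p \<in> E" using insert by blast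
    have eq: "gen_field (insert s M) = ?N"
      using gen_field_insert_eq[OF insert.prems(2) p, of s 1] s insert.prems(3) by auto
    then have N: "is_subfield ?N" "insert s M \<subseteq> ?N"
      using is_subfield_gen_field gen_field_superset by metis+
    obtain D1 where D1: "D1 \<in> der ?N" "\<forall>y\<in>M. D1 y = D y"
      using der_extend_adjoin[OF p insert.prems(2) False, of D 0] s insert.prems N
      by (auto simp: relder_def subfield_0)
    then have "D1 \<in> relder ?N E"
      using insert.prems by (auto simp: relder_def)
    then obtain D2 where D2: "D2 \<in> relder (gen_field (?N \<union> S)) E" "\<forall>y\<in>?N. D2 y = D1 y"
      using insert.IH[of ?N D1] insert.prems N by auto
    have "gen_field (?N \<union> S) = gen_field (M \<union> insert s S)"
      unfolding eq[symmetric] gen_field_gen_field by simp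
    then show ?thesis using D1 D2 N by (metis insert_subset subsetD)
  qed
qed

text \<open>If \<open>x\<close> lies in \<open>F\<close> but not in \<open>E\<close>, some
  derivation of \<open>E(x)\<close> kills \<open>E\<close> and sends \<open>x\<close> to 1; extended
  over the remaining generators it shows that \<open>x\<close> is not annihilated.\<close>

proposition Ann_relder:
  assumes p: "prime p" "CHAR('a::field) = p"
    and E: "is_subfield E" "E \<subseteq> F" and F: "F = gen_field (E \<union> S)" "(\<lambda>x. x ^ p) ` F \<subseteq> (E :: 'a set)"
    and S: "finite S"
  shows "Ann F (relder F E) = E"
proof
  show "E \<subseteq> Ann F (relder F E)" using E by (auto simp: Ann_def relder_def)
  show "Ann F (relder F E) \<subseteq> E"
  proof
    fix x assume x: "x \<in> Ann F (relder F E)"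
    show "x \<in> E"
    proof (rule ccontr)
      assume "x \<notin> E"
      let ?N = "poly_adjoin E x"
      have "x \<in> F" using x by (simp add: Ann_def)
      then have xp: "x ^ p \<in> E" using F by auto
      have eq: "gen_field (insert x E) = ?N"
        using gen_field_insert_eq[OF E(1) p, of x 1] xp by auto
      then have N: "is_subfield ?N" "insert x E \<subseteq> ?N"
        using is_subfield_gen_field gen_field_superset by metis+
      have "(\<lambda>_. 0) \<in> der E" using E by (auto simp: der_def subfield_0)
      then obtain D where D: "D \<in> der ?N" "\<forall>y\<in>E. D y = 0" "D x = 1"
        using der_extend_adjoin[OF p E(1) \<open>x \<notin> E\<close> xp, of "\<lambda>_. 0" 1] N
        by (auto simp: subfield_1)
      have "s ^ p \<in> E" if "s \<in> S" for s
        using that F gen_field_superset[of "E \<union> S"] by auto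
      then obtain D' where D': "D' \<in> relder (gen_field (?N \<union> S)) E" "\<forall>y\<in>?N. D' y = D y"
        using der_extend_finite[OF p S _ N(1), of E D] D N by (auto simp: relder_def)
      have "gen_field (?N \<union> S) = gen_field (insert x (E \<union> S))"
        unfolding eq[symmetric] gen_field_gen_field by simp
      also have "\<dots> = F"
        using gen_field_absorb[of "{x}" "E \<union> S"] \<open>x \<in> F\<close> F(1) by simp
      finally have "D' x = 0" using D' x by (auto simp: Ann_def)
      then show False using D D' N by auto
    qed
  qed
qed

section \<open>Finite generation of intermediate fields\<close>

text \<open>Linear combinations built one term at a time, so that proofs are inductions without
  coefficient functions.\<close>

inductive_set lin_span :: "'a::field set \<Rightarrow> 'a set \<Rightarrow> 'a set" for N T where
  zero: "0 \<in> lin_span N T"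
| step: "c \<in> N \<Longrightarrow> t \<in> T \<Longrightarrow> v \<in> lin_span N T \<Longrightarrow> c * t + v \<in> lin_span N T"

lemma lin_span_scale_base: "c \<in> N \<Longrightarrow> t \<in> T \<Longrightarrow> c * t \<in> lin_span N T"
  using lin_span.step[OF _ _ lin_span.zero] by fastforce

lemma lin_span_add: "u \<in> lin_span N T \<Longrightarrow> v \<in> lin_span N T \<Longrightarrow> u + v \<in> lin_span N T"
  by (induction rule: lin_span.induct) (auto simp: add.assoc intro: lin_span.intros)

lemma lin_span_scale:
  assumes "is_subfield N" "c \<in> N"
  shows "v \<in> lin_span N T \<Longrightarrow> c * v \<in> lin_span N T"
  by (induction rule: lin_span.induct)
     (auto simp: distrib_left mult.assoc[symmetric] intro: lin_span.intros subfield_mult assms)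

lemma lin_span_mono: "S \<subseteq> T \<Longrightarrow> lin_span N S \<subseteq> lin_span N T"
proof
  fix v assume "S \<subseteq> T" "v \<in> lin_span N S"
  from this(2) show "v \<in> lin_span N T"
    by induction (use \<open>S \<subseteq> T\<close> in \<open>auto intro: lin_span.intros\<close>)
qed

lemma lin_span_insertD:
  assumes "is_subfield N"
  shows "v \<in> lin_span N (insert t T) \<Longrightarrow> \<exists>a\<in>N. \<exists>u\<in>lin_span N T. v = a * t + u"
proof (induction rule: lin_span.induct)
  case zero
  show ?case using assms by (intro bexI[of _ 0]) (auto intro: lin_span.zero subfield_0)
next
  case (step c s v)
  then obtain a u where au: "a \<in> N" "u \<in> lin_span N T" "v = a * t + u" by blast
  show ?case
  proof (cases "s = t")
    case True
    then have "c * s + v = (c + a) * t + u" by (simp add: au algebra_simps)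
    then show ?thesis using au step assms by (blast intro: subfield_add)
  next
    case False
    then have "c * s + v = a * t + (c * s + u)" by (simp add: au algebra_simps)
    then show ?thesis using au step False by (blast intro: lin_span.step)
  qed
qed

lemma lin_span_subset_gen_field: "lin_span N T \<subseteq> gen_field (N \<union> T)"
proof
  fix v assume "v \<in> lin_span N T"
  then show "v \<in> gen_field (N \<union> T)"
    by induction (use gen_field_superset[of "N \<union> T"] in
      \<open>auto intro!: subfield_add[OF is_subfield_gen_field] subfield_mult[OF is_subfield_gen_field]
         subfield_0[OF is_subfield_gen_field]\<close>)
qed

text \<open>Induction on the spanning set: one \<open>w\<close> in \<open>W\<close> with nonzero
  coefficient at \<open>t\<close> suffices in addition to generators of
  \<open>W \<inter> lin_span N T\<close>, since a multiple of \<open>w\<close> clears the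
  \<open>t\<close>-coefficient of any other element. The generators lie in \<open>W\<close> itself,
  as generators of a subfield must.\<close>

lemma finite_generation_subspace:
  assumes N: "is_subfield N" and T: "finite T"
    and W: "W \<subseteq> lin_span N T" "\<And>u v. u \<in> W \<Longrightarrow> v \<in> W \<Longrightarrow> u - v \<in> W"
      "\<And>c u. c \<in> N \<Longrightarrow> u \<in> W \<Longrightarrow> c * u \<in> W"
  shows "\<exists>S. finite S \<and> S \<subseteq> W \<and> W \<subseteq> lin_span N S"
  using T W
proof (induction T arbitrary: W rule: finite_induct)
  case empty
  then show ?case by (intro exI[of _ "{}"]) auto
next
  case (insert t T)
  have T: "u - v \<in> lin_span N T" if "u \<in> lin_span N T" "v \<in> lin_span N T" for u v
    using lin_span_add[OF that(1) lin_span_scale[OF N subfield_minus[OF N subfield_1[OF N]] that(2)]]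
    by simp
  let ?W = "W \<inter> lin_span N T"
  have "\<exists>S. finite S \<and> S \<subseteq> ?W \<and> ?W \<subseteq> lin_span N S"
    by (rule insert.IH) (use insert.prems T N in \<open>auto intro: lin_span_scale\<close>)
  then obtain S where S: "finite S" "S \<subseteq> ?W" "?W \<subseteq> lin_span N S" by blast
  show ?case
  proof (cases "W \<subseteq> lin_span N T")
    case True
    then show ?thesis using S by (intro exI[of _ S]) auto
  next
    case False
    then obtain w where w: "w \<in> W" "w \<notin> lin_span N T" by blast
    obtain a u where au: "a \<in> N" "u \<in> lin_span N T" "w = a * t + u"
      using lin_span_insertD[OF N] insert.prems(1) w by blast
    have "a \<noteq> 0" using au w by auto
    have "W \<subseteq> lin_span N (insert w S)"
    proof
      fix y assume y: "y \<in> W"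
      obtain b v where bv: "b \<in> N" "v \<in> lin_span N T" "y = b * t + v"
        using lin_span_insertD[OF N] insert.prems(1) y by blast
      let ?c = "b * inverse a"
      have c: "?c \<in> N" using au bv N by (intro subfield_mult subfield_inverse)
      have "y - ?c * w = v - ?c * u"
        using \<open>a \<noteq> 0\<close> by (simp add: au bv field_simps)
      then have "y - ?c * w \<in> lin_span N T"
        using T[OF bv(2) lin_span_scale[OF N c au(2)]] by (simp only:)
      moreover have "y - ?c * w \<in> W" using insert.prems y w c by blast
      ultimately have "y - ?c * w \<in> lin_span N S" using S by blast
      then have "?c * w + (y - ?c * w) \<in> lin_span N (insert w S)"
        using c lin_span_mono[of S "insert w S"] by (intro lin_span.step) auto
      then show "y \<in> lin_span N (insert w S)" by simp
    qed
    then show ?thesis using S w by (intro exI[of _ "insert w S"]) auto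
  qed
qed

text \<open>Adjoining \<open>s\<close> multiplies the spanning set by the powers
  \<open>s ^ k\<close> with \<open>k < p ^ n\<close>. Multiplication by \<open>s\<close> preserves
  the new span, because \<open>s ^ (p ^ n)\<close> is a scalar, and so Horner's scheme reaches every
  polynomial in \<open>s\<close>.\<close>

lemma finite_span_gen_field:
  assumes p: "prime p" "CHAR('a::field) = p" and N: "is_subfield (N :: 'a set)"
    and S: "finite S" "\<And>s. s \<in> S \<Longrightarrow> s ^ (p ^ n) \<in> N"
  shows "\<exists>T. finite T \<and> gen_field (N \<union> S) \<subseteq> lin_span N T"
  using S
proof (induction S rule: finite_induct)
  case empty
  have "gen_field N \<subseteq> N" using N gen_field_least by blast
  moreover have "c \<in> lin_span N {1}" if "c \<in> N" for c
    using lin_span_scale_base[of c N 1 "{1}"] that by simp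
  ultimately show ?case by (intro exI[of _ "{1}"]) auto
next
  case (insert s S)
  then obtain T where T: "finite T" "gen_field (N \<union> S) \<subseteq> lin_span N T" by auto
  let ?M = "gen_field (N \<union> S)" and ?q = "p ^ n"
  let ?T = "(\<lambda>(t, k). t * s ^ k) ` (T \<times> {..<?q})"
  have q: "?q > 0" using p(1) prime_gt_0_nat by simp
  have sq: "s ^ ?q \<in> N" using insert.prems by blast
  then have "s ^ ?q \<in> ?M" using gen_field_superset by blast
  have M: "v \<in> lin_span N ?T" if "v \<in> lin_span N T" for v
    using that
  proof induction
    case (step c t v)
    have "t = (\<lambda>(t, k). t * s ^ k) (t, 0)" by simp
    then have "t \<in> ?T" using step q by blast
    then show ?case using step by (intro lin_span.step) auto
  qed (rule lin_span.zero)
  have s: "s * v \<in> lin_span N ?T" if "v \<in> lin_span N ?T" for v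
    using that
  proof induction
    case (step c t' v)
    then obtain t k where tk: "t \<in> T" "k < ?q" "t' = t * s ^ k" by auto
    have "s * (c * t') \<in> lin_span N ?T"
    proof (cases "Suc k < ?q")
      case True
      then have "t * s ^ Suc k \<in> ?T" using tk by force
      then have "c * (t * s ^ Suc k) \<in> lin_span N ?T"
        using step by (intro lin_span_scale_base) auto
      then show ?thesis by (simp add: tk ac_simps)
    next
      case False
      then have "?q = Suc k" using tk by simp
      then have "s * s ^ k = s ^ ?q" by simp
      moreover have "(c * s ^ ?q) * t \<in> lin_span N ?T"
        using M[of "(c * s ^ ?q) * t"] step tk sq N
        by (simp add: lin_span_scale_base subfield_mult)
      moreover have "s * (c * (t * s ^ k)) = (c * (s * s ^ k)) * t" by (simp add: ac_simps)
      ultimately show ?thesis unfolding tk by (simp only:)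
    qed
    then show ?case using step lin_span_add by (simp add: distrib_left)
  qed (simp add: lin_span.zero)
  have "poly f s \<in> lin_span N ?T" if "over ?M f" for f
    using that
  proof (induction f)
    case (pCons c f)
    then show ?case
      using M T s by (auto simp: over_pCons[OF is_subfield_gen_field] intro!: lin_span_add)
  qed (simp add: lin_span.zero)
  moreover have "gen_field (N \<union> insert s S) = gen_field (insert s ?M)"
    using gen_field_gen_field[of "N \<union> S" "{s}"] by simp
  moreover have "gen_field (insert s ?M) = poly_adjoin ?M s"
    using gen_field_insert_eq[OF is_subfield_gen_field p \<open>s ^ ?q \<in> ?M\<close>] .
  ultimately have "gen_field (N \<union> insert s S) \<subseteq> lin_span N ?T"
    by (auto simp: poly_adjoin_def)
  then show ?case using T by (intro exI[of _ ?T]) auto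
qed

text \<open>Finite generation does not pass to subfields directly, but finite dimension does:
  \<open>K\<close> is finite-dimensional over \<open>?N\<close>, which contains
  \<open>pinf_field p\<close>, and \<open>W\<close> is a \<open>?N\<close>-subspace of it.\<close>

proposition finite_generation_over_pth_powers:
  assumes p: "prime p" "CHAR('a::field) = p" and K: "fin_gen_ext (pinf_field p :: 'a set)"
    and W: "is_subfield (W :: 'a set)" "pow_field p i \<subseteq> W"
  shows "\<exists>S. finite S \<and> S \<subseteq> W \<and> gen_field ((\<lambda>x. x ^ p) ` W \<union> S) = W"
proof -
  \<comment> \<open>The exponent is \<open>Suc i\<close> because the scalars have to lie among the
    p-th powers of \<open>W\<close>, and \<open>W\<close> contains
    \<open>pow_field p i\<close>.\<close>
  let ?N = "pow_field p (Suc i) :: 'a set"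
  have N: "is_subfield ?N" using is_subfield_pow_field[OF p] .
  have NW: "?N \<subseteq> (\<lambda>x. x ^ p) ` W" using W(2) by (auto simp: pow_field_Suc)
  have NW': "?N \<subseteq> W" using pow_field_antimono[of i "Suc i" p] W(2) by auto
  obtain S where S: "finite S" "gen_field (pinf_field p \<union> S) = (UNIV :: 'a set)"
    using K by (auto simp: fin_gen_ext_def)
  have "gen_field (pinf_field p \<union> S) \<subseteq> gen_field (?N \<union> S)"
    by (intro gen_field_mono) (auto simp: pinf_field_def)
  moreover obtain T where T: "finite T" "gen_field (?N \<union> S) \<subseteq> lin_span ?N T"
    using finite_span_gen_field[OF p N S(1), of "Suc i"] by (auto simp: pow_field_def)
  ultimately have "W \<subseteq> lin_span ?N T" using S by auto
  then obtain B where B: "finite B" "B \<subseteq> W" "W \<subseteq> lin_span ?N B"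
    using finite_generation_subspace[OF N T(1) _ subfield_diff[OF W(1)]
        subfield_mult[OF W(1) subsetD[OF NW']]] by blast
  have "gen_field ((\<lambda>x. x ^ p) ` W \<union> B) \<subseteq> W"
    using B by (intro gen_field_least[OF W(1)]) (auto intro: subfield_power[OF W(1)])
  moreover have "W \<subseteq> gen_field ((\<lambda>x. x ^ p) ` W \<union> B)"
    using B(3) lin_span_subset_gen_field[of ?N B] gen_field_mono[of "?N \<union> B" "(\<lambda>x. x ^ p) ` W \<union> B"] NW
    by blast
  ultimately show ?thesis using B by blast
qed

section \<open>Dimensions\<close>

text \<open>Bases arise below as indexed families, while \<open>has_dim\<close> asks for a set. The
  scalar action stays general to cover field elements as well as derivations.\<close>

lemma has_dim_family:
  assumes I: "finite I" "inj_on v I" "v ` I \<subseteq> V"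
    and span: "V = {\<Sum>i\<in>I. sc (c i) (v i) | c. \<forall>i\<in>I. c i \<in> S}"
    and indep: "\<And>c. \<forall>i\<in>I. c i \<in> S \<Longrightarrow> (\<Sum>i\<in>I. sc (c i) (v i)) = 0 \<Longrightarrow> \<forall>i\<in>I. c i = 0"
  shows "has_dim sc S V (card I)"
  unfolding has_dim_def
proof (intro exI[of _ "v ` I"] conjI allI impI)
  have reindex: "(\<Sum>b\<in>v ` I. sc (c b) b) = (\<Sum>i\<in>I. sc (c (v i)) (v i))" for c
    using I(2) by (simp add: sum.reindex)
  have "\<exists>c'. (\<forall>b\<in>v ` I. c' b \<in> S) \<and> (\<Sum>b\<in>v ` I. sc (c' b) b) = (\<Sum>i\<in>I. sc (c i) (v i))"
    if "\<forall>i\<in>I. c i \<in> S" for c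
  proof (intro exI conjI)
    let ?c = "\<lambda>b. c (the_inv_into I v b)"
    show "\<forall>b\<in>v ` I. ?c b \<in> S" using that I(2) by (auto simp: the_inv_into_f_f)
    show "(\<Sum>b\<in>v ` I. sc (?c b) b) = (\<Sum>i\<in>I. sc (c i) (v i))"
      unfolding reindex using I(2) by (intro sum.cong) (auto simp: the_inv_into_f_f)
  qed
  note ex = this
  show "V = {\<Sum>b\<in>v ` I. sc (c b) b |c. \<forall>b\<in>v ` I. c b \<in> S}"
  proof (intro set_eqI iffI)
    fix y assume "y \<in> V"
    then obtain c where c: "\<forall>i\<in>I. c i \<in> S" "y = (\<Sum>i\<in>I. sc (c i) (v i))" using span by blast
    obtain c' where c': "\<forall>b\<in>v ` I. c' b \<in> S"
      "(\<Sum>b\<in>v ` I. sc (c' b) b) = (\<Sum>i\<in>I. sc (c i) (v i))"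
      using ex[OF c(1)] by (elim exE conjE)
    show "y \<in> {\<Sum>b\<in>v ` I. sc (c b) b |c. \<forall>b\<in>v ` I. c b \<in> S}"
      using c(2) c' by (intro CollectI exI[of _ c'] conjI) (simp_all only:)
  next
    fix y assume "y \<in> {\<Sum>b\<in>v ` I. sc (c b) b |c. \<forall>b\<in>v ` I. c b \<in> S}"
    then obtain c where c: "\<forall>b\<in>v ` I. c b \<in> S" "y = (\<Sum>b\<in>v ` I. sc (c b) b)"
      by blast
    then have "y \<in> {\<Sum>i\<in>I. sc (c i) (v i) | c. \<forall>i\<in>I. c i \<in> S}"
      unfolding reindex by (intro CollectI exI[of _ "\<lambda>i. c (v i)"]) simp
    then show "y \<in> V" using span by (simp only:)
  qed
  show "\<forall>b\<in>v ` I. c b = 0" if "(\<forall>b\<in>v ` I. c b \<in> S) \<and> (\<Sum>b\<in>v ` I. sc (c b) b) = 0" for c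
    using indep[of "\<lambda>i. c (v i)"] that unfolding reindex by auto
qed (use I in \<open>auto simp: card_image\<close>)

text \<open>Injectivity comes from independence: a repetition \<open>v i = v j\<close> would be the
  nontrivial relation \<open>v i - v j = 0\<close>.\<close>

lemma has_dim_family_mult:
  fixes S :: "'a::field set"
  assumes S: "is_subfield S" and I: "finite I"
    and span: "V = {\<Sum>i\<in>I. c i * v i | c. \<forall>i\<in>I. c i \<in> S}"
    and indep: "\<And>c. \<forall>i\<in>I. c i \<in> S \<Longrightarrow> (\<Sum>i\<in>I. c i * v i) = 0 \<Longrightarrow> \<forall>i\<in>I. c i = 0"
  shows "has_dim (*) S V (card I)"
proof (rule has_dim_family)
  have delta: "(\<Sum>i\<in>I. (if i = j then a else 0) * v i) = a * v j" if "j \<in> I" for a j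
  proof -
    have "(\<Sum>i\<in>I. (if i = j then a else 0) * v i) = (\<Sum>i\<in>I. if i = j then a * v i else 0)"
      by (intro sum.cong) auto
    then show ?thesis using I that by simp
  qed
  show "inj_on v I"
  proof (rule inj_onI)
    fix i j assume ij: "i \<in> I" "j \<in> I" "v i = v j"
    show "i = j"
    proof (rule ccontr)
      assume "i \<noteq> j"
      let ?c = "\<lambda>k. (if k = i then 1 else 0) + (if k = j then - 1 else 0) :: 'a"
      have "(\<Sum>k\<in>I. ?c k * v k) = 0"
        unfolding distrib_right sum.distrib using delta ij by simp
      moreover have "\<forall>k\<in>I. ?c k \<in> S"
        using S by (auto intro: subfield_closed)
      ultimately have "?c i = 0" using indep[of ?c] ij by blast
      then show False using \<open>i \<noteq> j\<close> by simp
    qed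
  qed
  show "v ` I \<subseteq> V"
  proof
    fix y assume "y \<in> v ` I"
    then obtain j where "j \<in> I" "y = v j" by blast
    then show "y \<in> V"
      unfolding span using delta[of j 1] S
      by (intro CollectI exI[of _ "\<lambda>i. if i = j then 1 else 0"]) (auto simp: subfield_0 subfield_1)
  qed
qed (use assms in blast)+

lemma has_dim_self: "is_subfield F \<Longrightarrow> has_dim (*) F F 1"
  using has_dim_family_mult[of F "{()}" F "\<lambda>_. 1"] by force

text \<open>The classical product basis; indexing by pairs leaves the distinctness of the products
  to \<open>has_dim_family_mult\<close>.\<close>

lemma has_dim_tower:
  assumes A: "is_subfield A" and B: "is_subfield B" and AB: "has_dim (*) A B m" and BC: "has_dim (*) B C n"
  shows "has_dim (*) A C (m * n)"
proof -
  obtain S where S: "finite S" "card S = m" "S \<subseteq> B"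
    "B = {\<Sum>b\<in>S. c b * b | c. \<forall>b\<in>S. c b \<in> A}"
    "\<And>c. (\<forall>b\<in>S. c b \<in> A) \<Longrightarrow> (\<Sum>b\<in>S. c b * b) = 0 \<Longrightarrow> \<forall>b\<in>S. c b = 0"
    using AB unfolding has_dim_def by blast
  obtain T where T: "finite T" "card T = n"
    "C = {\<Sum>b\<in>T. c b * b | c. \<forall>b\<in>T. c b \<in> B}"
    "\<And>c. (\<forall>b\<in>T. c b \<in> B) \<Longrightarrow> (\<Sum>b\<in>T. c b * b) = 0 \<Longrightarrow> \<forall>b\<in>T. c b = 0"
    using BC unfolding has_dim_def by blast
  have sum: "(\<Sum>i\<in>T \<times> S. c i * (case i of (t, s) \<Rightarrow> s * t)) = (\<Sum>t\<in>T. (\<Sum>s\<in>S. c (t, s) * s) * t)" for c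
    by (simp add: sum.cartesian_product sum_distrib_right mult.assoc case_prod_unfold)
  have inner: "(\<Sum>s\<in>S. c s * s) \<in> B" if "\<forall>s\<in>S. c s \<in> A" for c
    using that S(4) by blast
  have "has_dim (*) A C (card (T \<times> S))"
  proof (rule has_dim_family_mult[OF A, where v = "\<lambda>(t, s). s * t"])
    show "finite (T \<times> S)" using S T by simp
    show "C = {\<Sum>i\<in>T \<times> S. c i * (case i of (t, s) \<Rightarrow> s * t) |c. \<forall>i\<in>T \<times> S. c i \<in> A}"
      unfolding sum
    proof (intro set_eqI iffI)
      fix y assume "y \<in> C"
      then obtain c where c: "\<forall>t\<in>T. c t \<in> B" "y = (\<Sum>t\<in>T. c t * t)" using T(3) by blast
      then have "\<forall>t\<in>T. \<exists>d. (\<forall>s\<in>S. d s \<in> A) \<and> c t = (\<Sum>s\<in>S. d s * s)"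
        using S(4) by blast
      then obtain d where d: "\<forall>t\<in>T. (\<forall>s\<in>S. d t s \<in> A) \<and> c t = (\<Sum>s\<in>S. d t s * s)"
        by metis
      show "y \<in> {\<Sum>t\<in>T. (\<Sum>s\<in>S. c (t, s) * s) * t |c. \<forall>i\<in>T \<times> S. c i \<in> A}"
        using c d by (intro CollectI exI[of _ "\<lambda>(t, s). d t s"]) auto
    next
      fix y assume "y \<in> {\<Sum>t\<in>T. (\<Sum>s\<in>S. c (t, s) * s) * t |c. \<forall>i\<in>T \<times> S. c i \<in> A}"
      then obtain c where c: "\<forall>i\<in>T \<times> S. c i \<in> A" "y = (\<Sum>t\<in>T. (\<Sum>s\<in>S. c (t, s) * s) * t)" by blast
      show "y \<in> C" unfolding T(3)
        using c inner by (intro CollectI exI[of _ "\<lambda>t. \<Sum>s\<in>S. c (t, s) * s"]) auto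
    qed
    fix c assume c: "\<forall>i\<in>T \<times> S. c i \<in> A" "(\<Sum>i\<in>T \<times> S. c i * (case i of (t, s) \<Rightarrow> s * t)) = 0"
    then have "\<forall>t\<in>T. (\<Sum>s\<in>S. c (t, s) * s) = 0"
      using inner unfolding sum by (intro T(4)) auto
    then have "\<forall>s\<in>S. c (t, s) = 0" if "t \<in> T" for t
      using that c by (intro S(5)) auto
    then show "\<forall>i\<in>T \<times> S. c i = 0" by auto
  qed
  then show ?thesis using S T by (simp add: card_cartesian_product mult.commute)
qed

section \<open>Jacobson's correspondence in exponent one\<close>

lemma p_lieD:
  assumes "p_lie p F L"
  shows p_lie_der: "D \<in> L \<Longrightarrow> D \<in> der F"
    and p_lie_0: "(\<lambda>_. 0) \<in> L"
    and p_lie_add: "D \<in> L \<Longrightarrow> E \<in> L \<Longrightarrow> (\<lambda>x. D x + E x) \<in> L"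
    and p_lie_scale: "c \<in> F \<Longrightarrow> D \<in> L \<Longrightarrow> (\<lambda>x. c * D x) \<in> L"
    and p_lie_bracket: "D \<in> L \<Longrightarrow> E \<in> L \<Longrightarrow> (\<lambda>x. D (E x) - E (D x)) \<in> L"
    and p_lie_pth: "D \<in> L \<Longrightarrow> D ^^ p \<in> L"
  using assms unfolding p_lie_def by blast+

lemma p_lie_diff_scale:
  assumes F: "is_subfield F" and L: "p_lie p F L" and D: "D \<in> L" "E \<in> L" and c: "c \<in> F"
  shows "(\<lambda>x. D x - c * E x) \<in> L"
  using p_lie_add[OF L D(1) p_lie_scale[OF L subfield_minus[OF F c] D(2)]] by simp

lemma p_lie_sum:
  assumes "p_lie p F L" "\<And>i. i \<in> I \<Longrightarrow> c i \<in> F" "\<And>i. i \<in> I \<Longrightarrow> D i \<in> L"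
  shows "(\<lambda>x. \<Sum>i\<in>I. c i * D i x) \<in> L"
  using assms(2,3)
proof (induction I rule: infinite_finite_induct)
  case (insert i I)
  then have "(\<lambda>x. \<Sum>i\<in>I. c i * D i x) \<in> L" "(\<lambda>x. c i * D i x) \<in> L"
    using p_lie_scale[OF assms(1)] by auto
  from p_lie_add[OF assms(1) this(2,1)] show ?case using insert by simp
qed (use p_lie_0[OF assms(1)] in auto)

text \<open>Row reduction of the matrix of values \<open>D s\<close>: the elements of
  \<open>X\<close> are the pivot columns and the \<open>d x\<close> the reduced rows. An element
  \<open>s\<close> becomes a pivot when some \<open>D\<close> in \<open>L\<close> vanishes on the
  earlier pivots but not at \<open>s\<close>.\<close>

lemma dual_family:
  assumes F: "is_subfield F" and L: "p_lie p F L" and S: "finite S" "S \<subseteq> F"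
  shows "\<exists>X d. X \<subseteq> S \<and> (\<forall>x\<in>X. d x \<in> L) \<and> (\<forall>x\<in>X. \<forall>y\<in>X. d x y = (if x = y then 1 else 0)) \<and>
    (\<forall>D\<in>L. (\<forall>x\<in>X. D x = 0) \<longrightarrow> (\<forall>s\<in>S. D s = 0))"
  using S
proof (induction S rule: finite_induct)
  case (insert s S)
  then obtain X d where X: "X \<subseteq> S" "\<forall>x\<in>X. d x \<in> L"
    "\<forall>x\<in>X. \<forall>y\<in>X. d x y = (if x = y then 1 else 0)"
    "\<forall>D\<in>L. (\<forall>x\<in>X. D x = 0) \<longrightarrow> (\<forall>s\<in>S. D s = 0)"
    by auto
  show ?case
  proof (cases "\<forall>D\<in>L. (\<forall>x\<in>X. D x = 0) \<longrightarrow> D s = 0")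
    case True
    then show ?thesis using X by (intro exI[of _ X] exI[of _ d]) auto
  next
    case False
    then obtain D where D: "D \<in> L" "\<forall>x\<in>X. D x = 0" "D s \<noteq> 0" by blast
    define E where "E = (\<lambda>x. inverse (D s) * D x)"
    have "D s \<in> F" using D insert.prems p_lie_der[OF L] der_closed by blast
    then have E: "E \<in> L" "\<forall>x\<in>X. E x = 0" "E s = 1"
      using D p_lie_scale[OF L subfield_inverse[OF F \<open>D s \<in> F\<close>] D(1)] by (auto simp: E_def)
    \<comment> \<open>Subtracting \<open>d x s * E y\<close> clears the column \<open>s\<close> in
      the old rows and leaves the old pivots alone, because \<open>E\<close> vanishes on
      \<open>X\<close>.\<close>
    define d' where "d' = (\<lambda>x. if x = s then E else (\<lambda>y. d x y - d x s * E y))"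
    have "s \<notin> X" using X insert by blast
    have "d x s \<in> F" if "x \<in> X" for x
      using that X insert.prems p_lie_der[OF L] der_closed by blast
    then have "\<forall>x\<in>insert s X. d' x \<in> L"
      using X E p_lie_diff_scale[OF F L] by (auto simp: d'_def)
    moreover have "\<forall>x\<in>insert s X. \<forall>y\<in>insert s X. d' x y = (if x = y then 1 else 0)"
      using X E \<open>s \<notin> X\<close> by (auto simp: d'_def)
    moreover have "\<forall>D\<in>L. (\<forall>x\<in>insert s X. D x = 0) \<longrightarrow> (\<forall>t\<in>insert s S. D t = 0)"
      using X(4) by (metis insert_iff)
    moreover have "insert s X \<subseteq> insert s S" using X(1) by blast
    ultimately show ?thesis
      by (intro exI[of _ "insert s X"] exI[of _ d'] conjI)
  qed
qed (intro exI[of _ "{}"], auto)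

text \<open>A derivation with \<open>D x = 1\<close> and \<open>D ^ p = 0\<close> acts like \<open>d/dx\<close>: Taylor expansion
  identifies its domain with the truncated polynomials in \<open>x\<close> over the constants.\<close>

locale nilpotent_derivation =
  fixes p :: nat and F G :: "'a::field set" and D :: "'a \<Rightarrow> 'a" and x :: 'a
  assumes p: "prime p" "CHAR('a) = p"
    and F: "is_subfield F" and G: "is_subfield G" "G \<subseteq> F"
    and D: "D \<in> der F" "\<And>y. y \<in> G \<Longrightarrow> D y \<in> G"
    and x: "x \<in> G" "D x = 1"
    and nilpotent: "\<And>y. y \<in> G \<Longrightarrow> (D ^^ p) y = 0"
begin

definition C where "C = {y \<in> G. D y = 0}"

lemma C_subset: "C \<subseteq> G" "C \<subseteq> F"
  using G by (auto simp: C_def)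

lemma is_subfield_C: "is_subfield C"
proof -
  have "C = \<Inter>{G, {y \<in> F. D y = 0}}" using G by (auto simp: C_def)
  then show ?thesis
    using is_subfield_Inter[of "{G, {y \<in> F. D y = 0}}"] G is_subfield_kernel[OF F D(1)] by auto
qed

lemma funpow_closed: "y \<in> G \<Longrightarrow> (D ^^ n) y \<in> G"
  by (induction n) (auto intro: D)

lemma funpow_scale: "c \<in> C \<Longrightarrow> y \<in> F \<Longrightarrow> (D ^^ n) (c * y) = c * (D ^^ n) y"
proof (induction n)
  case (Suc n)
  then show ?case
    using C_subset by (auto simp: der_mult[OF D(1)] der_funpow_closed[OF D(1)] C_def)
qed simp

lemma funpow_x: "(D ^^ n) (x ^ n) = of_nat (fact n)"
proof (induction n)
  case (Suc n)
  have "x \<in> F" using x G by blast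
  have "(D ^^ Suc n) (x ^ Suc n) = (D ^^ n) (D (x ^ Suc n))"
    by (simp add: funpow_swap1)
  also have "D (x ^ Suc n) = of_nat (Suc n) * x ^ n"
    using der_power[OF F D(1) \<open>x \<in> F\<close>, of "Suc n"] x by simp
  also have "(D ^^ n) (of_nat (Suc n) * x ^ n) = of_nat (Suc n) * (D ^^ n) (x ^ n)"
    by (intro funpow_scale subfield_of_nat is_subfield_C subfield_power F \<open>x \<in> F\<close>)
  finally show ?case unfolding Suc by (simp add: algebra_simps)
qed simp

text \<open>The Taylor coefficients divide by \<open>n!\<close>, which is invertible only below
  \<open>p\<close>; hence expansions stop at degree \<open>p - 1\<close>.\<close>

lemma fact_ne_0: "n < p \<Longrightarrow> of_nat (fact n) \<noteq> (0::'a)"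
  using p prime_dvd_fact_iff[of p n] by (simp add: of_nat_eq_0_iff_char_dvd)

lemma fact_in_C: "of_nat (fact n) \<in> C"
  by (rule subfield_of_nat[OF is_subfield_C])

lemma funpow_x_less: "k < n \<Longrightarrow> (D ^^ n) (x ^ k) = 0"
proof -
  assume "k < n"
  then obtain m where "n = m + Suc k" by (metis add_Suc_right less_iff_Suc_add add.commute)
  moreover have "(D ^^ Suc k) (x ^ k) = 0"
    using funpow_x[of k] fact_in_C[of k] by (simp add: C_def)
  ultimately show ?thesis by (simp only: funpow_add comp_apply der_funpow_0[OF F D(1)])
qed

text \<open>If \<open>n + 1\<close> applications of \<open>D\<close> kill \<open>y\<close>, then
  \<open>(D ^^ n) y\<close> is a constant \<open>z\<close>, and subtracting \<open>z / n!\<close>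
  times \<open>x ^ n\<close> leaves an element killed by \<open>n\<close> applications. For
  \<open>n = p\<close> this covers all of \<open>G\<close>.\<close>

lemma taylor:
  assumes "n \<le> p" "y \<in> G" "(D ^^ n) y = 0"
  shows "\<exists>c. (\<forall>k<n. c k \<in> C) \<and> y = (\<Sum>k<n. c k * x ^ k)"
  using assms
proof (induction n arbitrary: y)
  case (Suc n)
  define z where "z = (D ^^ n) y"
  have "z \<in> C" using Suc.prems funpow_closed by (simp add: C_def z_def)
  define a where "a = z * inverse (of_nat (fact n))"
  have a: "a \<in> C" using \<open>z \<in> C\<close> is_subfield_C fact_in_C
    unfolding a_def by (intro subfield_mult subfield_inverse)
  have xn: "x ^ n \<in> G" "a * x ^ n \<in> G" using a x G C_subset by (auto intro: subfield_power subfield_mult)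
  have "(D ^^ n) (y - a * x ^ n) = (D ^^ n) y - (D ^^ n) (a * x ^ n)"
    using der_funpow_add[OF D(1), of "y - a * x ^ n" "a * x ^ n" n] Suc.prems(2) xn G
    by (simp add: subfield_diff subset_iff)
  also have "\<dots> = z - a * of_nat (fact n)"
    using xn G a by (subst funpow_scale) (auto simp: funpow_x z_def)
  also have "\<dots> = 0" using fact_ne_0[of n] Suc.prems(1) by (simp add: a_def)
  finally obtain c where c: "\<forall>k<n. c k \<in> C" "y - a * x ^ n = (\<Sum>k<n. c k * x ^ k)"
    using Suc.IH[of "y - a * x ^ n"] Suc.prems xn G by (auto intro: subfield_diff)
  have "(\<Sum>k<n. (c(n := a)) k * x ^ k) = (\<Sum>k<n. c k * x ^ k)" by (intro sum.cong) auto
  then have "y = (\<Sum>k<Suc n. (c(n := a)) k * x ^ k)"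
    using c(2) by (simp add: algebra_simps)
  then show ?case using c a by (intro exI[of _ "c(n := a)"]) (auto simp: less_Suc_eq)
qed auto

text \<open>Applying \<open>D ^^ n\<close> to a relation with top power \<open>x ^ n\<close> kills
  the lower terms and leaves \<open>c n * n! = 0\<close>.\<close>

lemma independent_powers:
  assumes "n \<le> p" "\<forall>k<n. c k \<in> C" "(\<Sum>k<n. c k * x ^ k) = 0"
  shows "\<forall>k<n. c k = 0"
  using assms
proof (induction n)
  case (Suc n)
  have xk: "x ^ k \<in> F" for k using x G F by (auto intro: subfield_power)
  have scaled: "(D ^^ n) (c k * x ^ k) = c k * (D ^^ n) (x ^ k)" if "k \<le> n" for k
    using that Suc.prems xk by (intro funpow_scale) auto
  have cF: "c k * x ^ k \<in> F" if "k \<le> n" for k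
    using that Suc.prems C_subset xk F by (auto intro!: subfield_mult)
  have "(D ^^ n) (\<Sum>k<n. c k * x ^ k) = 0"
  proof -
    have "(D ^^ n) (\<Sum>k<m. c k * x ^ k) = 0" if "m \<le> n" for m
      using that
    proof (induction m)
      case (Suc m)
      have "(\<Sum>k<m. c k * x ^ k) \<in> F" using Suc.prems cF F by (auto intro!: subfield_sum)
      then have "(D ^^ n) (\<Sum>k<Suc m. c k * x ^ k) = (D ^^ n) (\<Sum>k<m. c k * x ^ k) + (D ^^ n) (c m * x ^ m)"
        using Suc.prems cF by (simp add: der_funpow_add[OF D(1)])
      then show ?case using Suc scaled funpow_x_less[of m n] by simp
    qed (simp add: der_funpow_0[OF F D(1)])
    then show ?thesis by simp
  qed
  moreover have "(\<Sum>k<n. c k * x ^ k) \<in> F" using cF F by (auto intro!: subfield_sum)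
  then have "(D ^^ n) (\<Sum>k<Suc n. c k * x ^ k) = (D ^^ n) (\<Sum>k<n. c k * x ^ k) + (D ^^ n) (c n * x ^ n)"
    using cF by (simp add: der_funpow_add[OF D(1)])
  ultimately have "c n * of_nat (fact n) = 0"
    using Suc.prems(3) scaled[of n] by (simp add: funpow_x der_funpow_0[OF F D(1)] del: sum.lessThan_Suc)
  then have "c n = 0" using fact_ne_0[of n] Suc.prems(1) by simp
  moreover have "\<forall>k<n. c k = 0"
    by (rule Suc.IH) (use Suc.prems \<open>c n = 0\<close> in simp_all)
  ultimately show ?case by (simp add: less_Suc_eq)
qed simp

lemma has_dim_constants: "has_dim (*) C G p"
proof -
  have "has_dim (*) C G (card {..<p})"
  proof (rule has_dim_family_mult[OF is_subfield_C, where v = "\<lambda>k. x ^ k"])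
    show "G = {\<Sum>k<p. c k * x ^ k |c. \<forall>k\<in>{..<p}. c k \<in> C}"
    proof (intro set_eqI iffI)
      fix y assume "y \<in> G"
      then show "y \<in> {\<Sum>k<p. c k * x ^ k |c. \<forall>k\<in>{..<p}. c k \<in> C}"
        using taylor[of p y] nilpotent by auto
    next
      fix y assume "y \<in> {\<Sum>k<p. c k * x ^ k |c. \<forall>k\<in>{..<p}. c k \<in> C}"
      then show "y \<in> G" using G C_subset x
        by (auto intro!: subfield_sum subfield_mult intro: subfield_power)
    qed
  qed (use independent_powers[of p] in auto)
  then show ?thesis by simp
qed

text \<open>By Taylor expansion \<open>G\<close> is generated by \<open>x\<close> over
  \<open>C\<close>, and the kernel of \<open>E\<close> is a subfield. This is one rung of the climb
  from \<open>Ann F L\<close> to \<open>F\<close>.\<close>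

lemma der_eq_0_if_eq_0_on_constants:
  assumes "E \<in> der F" "\<And>c. c \<in> C \<Longrightarrow> E c = 0" "E x = 0" "y \<in> G"
  shows "E y = 0"
proof -
  obtain c where c: "\<forall>k<p. c k \<in> C" "y = (\<Sum>k<p. c k * x ^ k)"
    using taylor[of p y] nilpotent assms(4) by auto
  let ?N = "{y \<in> F. E y = 0}"
  have N: "is_subfield ?N" using is_subfield_kernel F assms(1) by blast
  have "c k \<in> ?N" if "k < p" for k using that c assms C_subset by auto
  moreover have "x \<in> ?N" using x G assms by auto
  ultimately have "y \<in> ?N"
    unfolding c(2) by (intro subfield_sum[OF N] subfield_mult[OF N] subfield_power[OF N]) auto
  then show ?thesis by blast
qed

end

text \<open>By Gaussian elimination \<open>L\<close> has a basis dual to some elements of \<open>F\<close>. An element of \<open>L\<close>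
  is determined by its values there, so the brackets and \<open>p\<close>-th powers of the basis vanish,
  and \<open>F\<close> is reached from \<open>Ann F L\<close> by steps of degree \<open>p\<close>, one for each basis element.\<close>

proposition jacobson_exponent_one:
  assumes p: "prime p" "CHAR('a::field) = p" and F: "is_subfield (F :: 'a set)" and L: "p_lie p F L"
    and S: "finite S" "S \<subseteq> F" "F \<subseteq> gen_field ((\<lambda>x. x ^ p) ` F \<union> S)"
  shows "relder F (Ann F L) = L"
    and "\<exists>e. has_dim (\<lambda>c D x. c * D x) F L e \<and> has_dim (*) (Ann F L) F (p ^ e)"
proof -
  obtain X d where Xd: "X \<subseteq> S" "\<forall>x\<in>X. d x \<in> L"
    "\<forall>x\<in>X. \<forall>y\<in>X. d x y = (if x = y then 1 else 0)"
    "\<forall>D\<in>L. (\<forall>x\<in>X. D x = 0) \<longrightarrow> (\<forall>s\<in>S. D s = 0)"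
    using dual_family[OF F L S(1,2)] by (elim exE conjE)
  then have X: "X \<subseteq> S" "\<And>x. x \<in> X \<Longrightarrow> d x \<in> L"
    "\<And>x y. x \<in> X \<Longrightarrow> y \<in> X \<Longrightarrow> d x y = (if x = y then 1 else 0)"
    "\<And>D s. D \<in> L \<Longrightarrow> \<forall>x\<in>X. D x = 0 \<Longrightarrow> s \<in> S \<Longrightarrow> D s = 0"
    by (simp_all only:)
  have fin: "finite X" and XF: "X \<subseteq> F" using X S by (auto intro: finite_subset)
  have p2: "p \<ge> 2" using p(1) prime_ge_2_nat by blast
  have pth: "D (y ^ p) = 0" if "D \<in> der F" "y \<in> F" for D y
  proof -
    have "of_nat p = (0::'a)" using p by (simp add: of_nat_eq_0_iff_char_dvd)
    then show ?thesis using der_power[OF F that, of p] by simp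
  qed
  \<comment> \<open>Vanishing on \<open>X\<close> spreads to \<open>S\<close> by the choice of
    \<open>X\<close>, and p-th powers are killed anyway, so all generators of \<open>F\<close> are
    covered.\<close>
  have L0: "D y = 0" if D: "D \<in> L" "\<forall>x\<in>X. D x = 0" for D y
  proof (cases "y \<in> F")
    case True
    show ?thesis
      by (rule der_eq_0_gen_field[OF F p_lie_der[OF L D(1)], of "(\<lambda>x. x ^ p) ` F \<union> S"])
         (use S True D X(4) p_lie_der[OF L] pth in \<open>auto intro: subfield_power[OF F]\<close>)
  qed (use p_lie_der[OF L] D der_outside in blast)
  have d: "d x \<in> der F" if "x \<in> X" for x using that X p_lie_der[OF L] by blast
  \<comment> \<open>The inner value is 0 or 1, and derivations kill both.\<close>
  have d01: "d x (d y z) = 0" if "x \<in> X" "y \<in> X" "z \<in> X" for x y z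
    using X(3)[OF that(2,3)] der_0[OF F] der_1[OF F] d that by auto
  have comm: "d x (d y z) = d y (d x z)" if "x \<in> X" "y \<in> X" for x y z
  proof -
    have "\<forall>v\<in>X. d x (d y v) - d y (d x v) = 0"
      using d01[OF that] d01[OF that(2,1)] by simp
    from L0[OF p_lie_bracket[OF L X(2)[OF that(1)] X(2)[OF that(2)]] this, of z]
    show ?thesis by (simp only: right_minus_eq)
  qed
  have nil: "(d x ^^ p) y = 0" if "x \<in> X" for x y
  proof -
    \<comment> \<open>Two applications already give 0 on \<open>X\<close>, and \<open>p\<close> is
      at least 2.\<close>
    define q where "q = p - 2"
    have q: "p = q + Suc (Suc 0)" using p2 by (simp add: q_def)
    have "(d x ^^ p) z = (d x ^^ q) (d x (d x z))" for z
      unfolding q funpow_add by simp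
    then have "\<forall>z\<in>X. (d x ^^ p) z = 0"
      using d01[OF \<open>x \<in> X\<close> \<open>x \<in> X\<close>] der_funpow_0[OF F d[OF \<open>x \<in> X\<close>]] by simp
    then show ?thesis by (rule L0[OF p_lie_pth[OF L X(2)[OF that]]])
  qed
  \<comment> \<open>The common constants of the \<open>d x\<close> for \<open>x\<close> in
    \<open>Y\<close>: a chain from \<open>G {} = F\<close> down to
    \<open>G X = Ann F L\<close>.\<close>
  define G where "G Y = {y \<in> F. \<forall>x\<in>Y. d x y = 0}" for Y
  have G: "is_subfield (G Y)" if "Y \<subseteq> X" for Y
    using is_subfield_Ann[OF F, of "d ` Y"] that d by (auto simp: G_def Ann_def)
  have step: "nilpotent_derivation p F (G Y) (d x) x" and step_C: "nilpotent_derivation.C (G Y) (d x) = G (insert x Y)"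
    if Y: "insert x Y \<subseteq> X" "x \<notin> Y" for x Y
  proof -
    show nd: "nilpotent_derivation p F (G Y) (d x) x"
    proof
      \<comment> \<open>Commutation with the other \<open>d z\<close> is what makes
        \<open>d x\<close> act on their constants.\<close>
      show "d x y \<in> G Y" if "y \<in> G Y" for y
        using that Y comm[of _ x y] d der_0[OF F d, of x] by (auto simp: G_def intro: der_closed)
      show "x \<in> G Y" using Y XF X(3) by (auto simp: G_def)
    qed (use p F G Y d X(3) nil in \<open>auto simp: G_def\<close>)
    show "nilpotent_derivation.C (G Y) (d x) = G (insert x Y)"
      using nilpotent_derivation.C_def[OF nd] by (auto simp: G_def)
  qed
  \<comment> \<open>The combination of the dual basis that has the same values on \<open>X\<close>
    as \<open>D\<close>.\<close>
  define proj where "proj D = (\<lambda>z. \<Sum>x\<in>X. D x * d x z)" for D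
  have proj_X: "proj D y = D y" if "y \<in> X" for D y
  proof -
    have "proj D y = (\<Sum>x\<in>X. if x = y then D y else 0)"
      unfolding proj_def using X(3) that by (intro sum.cong) auto
    then show ?thesis using fin that by simp
  qed
  \<comment> \<open>Stated for any \<open>M\<close> above \<open>L\<close>, since it is applied both
    to \<open>L\<close> and to \<open>relder F (Ann F L)\<close>.\<close>
  have minus_proj: "(\<lambda>z. D z - proj D z) \<in> M" if M: "p_lie p F M" "L \<subseteq> M" "D \<in> M" for D M
  proof -
    have "D x \<in> F" if "x \<in> X" for x
      using der_closed[OF p_lie_der[OF M(1,3)]] that XF by blast
    then have "proj D \<in> M" unfolding proj_def using M X(2) by (intro p_lie_sum) auto
    then show ?thesis using p_lie_diff_scale[OF F M(1,3) _ subfield_1[OF F]] by simp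
  qed
  have repr: "D = proj D" if D: "D \<in> L" for D
  proof
    fix z
    have "D z - proj D z = 0"
      by (rule L0[OF minus_proj[OF L order_refl D]]) (simp add: proj_X)
    then show "D z = proj D z" by simp
  qed
  have AnnG: "Ann F L = G X"
  proof
    show "Ann F L \<subseteq> G X" using X by (auto simp: Ann_def G_def)
    show "G X \<subseteq> Ann F L"
    proof
      fix y assume y: "y \<in> G X"
      have "D y = 0" if D: "D \<in> L" for D
      proof -
        have "proj D y = 0" using y by (simp add: proj_def G_def)
        then show ?thesis using repr[OF D] by metis
      qed
      then show "y \<in> Ann F L" using y by (auto simp: Ann_def G_def)
    qed
  qed
  have GF: "G {} = F" by (simp add: G_def)
  have L_sub: "L \<subseteq> relder F (Ann F L)"
    using p_lie_der[OF L] by (auto simp: relder_def Ann_def)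
  show "relder F (Ann F L) = L"
  proof
    show "relder F (Ann F L) \<subseteq> L"
    proof
      fix D assume D: "D \<in> relder F (Ann F L)"
      define E where "E = (\<lambda>z. D z - proj D z)"
      have "E \<in> relder F (Ann F L)"
        unfolding E_def using minus_proj[OF p_lie_relder[OF p F] L_sub D] .
      then have E: "E \<in> der F" "\<And>y. y \<in> G X \<Longrightarrow> E y = 0" by (auto simp: relder_def AnnG)
      have EX: "E x = 0" if "x \<in> X" for x using that by (simp add: E_def proj_X)
      \<comment> \<open>As \<open>Z\<close> grows to \<open>X\<close>, the field
        \<open>G (X - Z)\<close> grows from \<open>Ann F L\<close> to \<open>F\<close>. At each step
        \<open>E\<close> kills the constants of \<open>d z\<close> by induction and \<open>z\<close>
        itself by \<open>EX\<close>.\<close>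
      have kill: "\<forall>y\<in>G (X - Z). E y = 0" if "finite Z" "Z \<subseteq> X" for Z
        using that
      proof (induction Z rule: finite_induct)
        case (insert z Z)
        let ?Y = "X - insert z Z"
        have Y: "insert z ?Y \<subseteq> X" "z \<notin> ?Y" using insert by auto
        have "insert z ?Y = X - Z" using insert by auto
        then have "E y = 0" if "y \<in> G ?Y" for y
          using nilpotent_derivation.der_eq_0_if_eq_0_on_constants[OF step[OF Y] E(1) _ _ that]
            step_C[OF Y] insert EX by auto
        then show ?case by blast
      qed (use E in auto)
      have "E y = 0" for y
        using kill[OF fin order_refl] GF der_outside[OF E(1), of y] by (cases "y \<in> F") auto
      then have "D = proj D" by (simp add: E_def fun_eq_iff)
      moreover have "D x \<in> F" if "x \<in> X" for x
        using D that XF der_closed by (auto simp: relder_def)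
      then have "proj D \<in> L" unfolding proj_def using L X(2) by (intro p_lie_sum) auto
      ultimately show "D \<in> L" by simp
    qed
  qed (rule L_sub)
  have "has_dim (*) (G Y) F (p ^ card Y)" if "finite Y" "Y \<subseteq> X" for Y
    using that
  proof (induction Y rule: finite_induct)
    case empty
    then show ?case using has_dim_self[OF F] by (simp add: GF)
  next
    case (insert x Y)
    then have Y: "insert x Y \<subseteq> X" "x \<notin> Y" by auto
    have "has_dim (*) (G (insert x Y)) (G Y) p"
      using nilpotent_derivation.has_dim_constants[OF step[OF Y]] step_C[OF Y] by simp
    then have "has_dim (*) (G (insert x Y)) F (p * p ^ card Y)"
      using insert G by (intro has_dim_tower[of _ "G Y"]) auto
    then show ?case using insert by simp
  qed
  then have "has_dim (*) (Ann F L) F (p ^ card X)" using fin by (simp add: AnnG)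
  moreover have "has_dim (\<lambda>c D x. c * D x) F L (card X)"
  proof (rule has_dim_family[OF fin, where v = d])
    have sum_fun: "(\<Sum>i\<in>X. (\<lambda>z. c i * d i z)) = (\<lambda>z. \<Sum>i\<in>X. c i * d i z)" for c
      by (induction X rule: infinite_finite_induct) (auto simp: fun_eq_iff)
    show "inj_on d X" using X(3) by (metis inj_onI zero_neq_one)
    show "d ` X \<subseteq> L" using X(2) by blast
    show "L = {\<Sum>i\<in>X. (\<lambda>x. c i * d i x) |c. \<forall>i\<in>X. c i \<in> F}"
      unfolding sum_fun
    proof (intro set_eqI iffI)
      fix D assume D: "D \<in> L"
      have "\<forall>x\<in>X. D x \<in> F" using D XF p_lie_der[OF L] der_closed by blast
      then show "D \<in> {\<lambda>z. \<Sum>i\<in>X. c i * d i z |c. \<forall>i\<in>X. c i \<in> F}"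
        using repr[OF D] by (auto simp: proj_def)
    next
      fix D assume "D \<in> {\<lambda>z. \<Sum>i\<in>X. c i * d i z |c. \<forall>i\<in>X. c i \<in> F}"
      then show "D \<in> L" using X(2) by (auto intro!: p_lie_sum[OF L])
    qed
    fix c assume c: "(\<Sum>i\<in>X. (\<lambda>x. c i * d i x)) = 0"
    show "\<forall>i\<in>X. c i = 0"
    proof
      fix y assume y: "y \<in> X"
      have "0 = (\<Sum>i\<in>X. c i * d i y)"
        using c unfolding sum_fun by (simp add: fun_eq_iff)
      also have "\<dots> = (\<Sum>i\<in>X. if i = y then c y else 0)"
        using X(3) y by (intro sum.cong) auto
      finally show "c y = 0" using fin y by simp
    qed
  qed
  ultimately show "\<exists>e. has_dim (\<lambda>c D x. c * D x) F L e \<and> has_dim (*) (Ann F L) F (p ^ e)"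
    by blast
qed

section \<open>Power towers and Jacobson sequences\<close>

text \<open>A preimage under the Frobenius homomorphism; it allows statements about p-th powers to
  be checked on generators.\<close>

lemma is_subfield_pth_preimage:
  assumes p: "prime p" "CHAR('a::field) = p" and A: "is_subfield (A :: 'a set)"
  shows "is_subfield {x. x ^ p \<in> A}"
proof -
  have add: "(x + y) ^ p = x ^ p + y ^ p" for x y :: 'a
    by (rule freshmans_dream) (use p in auto)
  have diff: "(x - y) ^ p = x ^ p - y ^ p" for x y :: 'a
    using add[of "x - y" y] by (simp add: algebra_simps)
  have "0 < p" using p(1) prime_gt_0_nat by blast
  then show ?thesis
    using A unfolding is_subfield_def[of "{x. x ^ p \<in> A}"]
    by (auto simp: add diff power_mult_distrib power_inverse zero_power intro: subfield_closed)
qed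

lemma relder_self: "is_subfield A \<Longrightarrow> relder A A = {\<lambda>_. 0}"
  unfolding relder_def der_def by (auto simp: subfield_0 fun_eq_iff) metis

lemma Ann_zero: "Ann A {\<lambda>_. 0} = A"
  by (auto simp: Ann_def)

lemma pow_field_0: "pow_field p 0 = UNIV"
  by (auto simp: pow_field_def)

lemma power_tower_subfield: "power_tower p W \<Longrightarrow> is_subfield (W i)"
  and power_tower_compositum: "power_tower p W \<Longrightarrow> j \<le> i \<Longrightarrow> W j = gen_field (W i \<union> pow_field p j)"
  unfolding power_tower_def compositum_def by blast+

lemma power_tower_0: "power_tower p W \<Longrightarrow> W 0 = UNIV"
  using power_tower_compositum[of p W 0 0] gen_field_superset[of UNIV] by (auto simp: pow_field_0)

lemma power_tower_antimono: "power_tower p W \<Longrightarrow> j \<le> i \<Longrightarrow> W i \<subseteq> W j"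
  and power_tower_pow_field: "power_tower p W \<Longrightarrow> pow_field p j \<subseteq> W j"
  using power_tower_compositum[of p W j i] power_tower_compositum[of p W j j]
    gen_field_superset[of "W i \<union> pow_field p j"] gen_field_superset[of "W j \<union> pow_field p j"]
  by auto

section \<open>Jacobson sequences and length bounds\<close>

lemma jacobson_seq_p_lie: "jacobson_seq p F \<Longrightarrow> p_lie p (annseq F i) (F (Suc i))"
  by (cases i) (auto simp: jacobson_seq_def)

text \<open>At \<open>i = 0\<close> the condition is automatic: a derivation of \<open>K\<close>
  that vanishes on \<open>pow_field p 0\<close>, which is all of \<open>K\<close>, is zero.\<close>

lemma jacobson_seq_disjoint:
  "jacobson_seq p F \<Longrightarrow> F (Suc i) \<inter> relder (annseq F i) (pow_field p i) = {\<lambda>_. 0}"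
proof (cases "i = 0")
  case True
  assume F: "jacobson_seq p F"
  then have "(\<lambda>_. 0) \<in> F 1" "F 1 \<subseteq> der UNIV"
    by (auto simp: jacobson_seq_def p_lie_def)
  then show ?thesis using True by (auto simp: relder_def pow_field_0)
next
  case False
  assume "jacobson_seq p F"
  moreover have "i \<ge> 1" using False by simp
  ultimately show ?thesis unfolding jacobson_seq_def by blast
qed

lemma annseq_antimono_Suc: "annseq F (Suc i) \<subseteq> annseq F i"
  by (auto simp: Ann_def)

lemma jac_len_le_to_jac:
  fixes W :: "nat \<Rightarrow> 'a::field set"
  assumes "power_tower p W" "tower_len_le W n"
  shows "jac_len_le (to_jac W) n"
  unfolding jac_len_le_def
proof (intro allI impI)
  fix N assume "n < N"
  \<comment> \<open>The strict bound \<open>n < N\<close> puts both fields that define the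
    \<open>N\<close>-th entry into the stable range.\<close>
  then have "n \<le> N - 1" "n \<le> N" "N \<noteq> 0" by auto
  then have "W (N - 1) = W n" "W N = W n" "N \<noteq> 0"
    using assms(2) unfolding tower_len_le_def by blast+
  then show "to_jac W N = {\<lambda>_. 0}"
    using relder_self[OF power_tower_subfield[OF assms(1)]] by (simp add: to_jac_def)
qed

lemma tower_len_le_annseq: "jac_len_le F n \<Longrightarrow> tower_len_le (annseq F) n"
  unfolding tower_len_le_def
proof (intro allI impI)
  fix N assume F: "jac_len_le F n" and "n \<le> N"
  from this(2) show "annseq F N = annseq F n"
    by (induction N rule: dec_induct) (use F in \<open>auto simp: jac_len_le_def Ann_zero\<close>)
qed

context
  fixes p :: nat
  assumes p: "prime p" "CHAR('a::field) = p"
begin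

text \<open>\<open>W i\<close> is generated by \<open>W (Suc i)\<close> and
  \<open>pow_field p i\<close>, and the p-th powers of both lie in \<open>W (Suc i)\<close>. So each
  step of a power tower has exponent one.\<close>

lemma power_tower_pth_power:
  fixes W :: "nat \<Rightarrow> 'a set"
  assumes W: "power_tower p W" and x: "x \<in> W i"
  shows "x ^ p \<in> W (Suc i)"
proof -
  have "gen_field (W (Suc i) \<union> pow_field p i) \<subseteq> {x. x ^ p \<in> W (Suc i)}"
  proof (rule gen_field_least)
    show "is_subfield {x. x ^ p \<in> W (Suc i)}"
      using is_subfield_pth_preimage[OF p power_tower_subfield[OF W]] .
    have "x ^ p \<in> W (Suc i)" if "x \<in> pow_field p i" for x
      using that power_tower_pow_field[OF W, of "Suc i"] by (auto simp: pow_field_Suc)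
    then show "W (Suc i) \<union> pow_field p i \<subseteq> {x. x ^ p \<in> W (Suc i)}"
      using subfield_power[OF power_tower_subfield[OF W]] by blast
  qed
  then show ?thesis using x power_tower_compositum[OF W, of i "Suc i"] by auto
qed

lemma annseq_subfield:
  fixes F :: "nat \<Rightarrow> ('a \<Rightarrow> 'a) set"
  assumes F: "jacobson_seq p F"
  shows "is_subfield (annseq F i)"
proof (induction i)
  case (Suc i)
  then show ?case
    using is_subfield_Ann[OF Suc, of "F (Suc i)"] p_lie_der[OF jacobson_seq_p_lie[OF F]] by auto
qed (simp add: is_subfield_UNIV)

lemma annseq_pth_power:
  fixes F :: "nat \<Rightarrow> ('a \<Rightarrow> 'a) set"
  assumes F: "jacobson_seq p F" and x: "x \<in> annseq F i"
  shows "x ^ p \<in> annseq F (Suc i)"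
proof -
  have "of_nat p = (0::'a)" using p by (simp add: of_nat_eq_0_iff_char_dvd)
  then have "D (x ^ p) = 0" if "D \<in> F (Suc i)" for D
    using der_power[OF annseq_subfield[OF F] p_lie_der[OF jacobson_seq_p_lie[OF F] that] x, of p]
    by simp
  then show ?thesis
    using subfield_power[OF annseq_subfield[OF F] x] by (simp add: Ann_def)
qed

text \<open>Each passage to an annihilator keeps the p-th powers. The containment is what gives
  finite generation at every level of a Jacobson sequence.\<close>

lemma pow_field_subset_annseq:
  fixes F :: "nat \<Rightarrow> ('a \<Rightarrow> 'a) set"
  assumes "jacobson_seq p F"
  shows "pow_field p i \<subseteq> annseq F i"
proof (induction i)
  case (Suc i)
  then show ?case using annseq_pth_power[OF assms, of _ i] unfolding pow_field_Suc by blast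
qed simp

context
  assumes K: "fin_gen_ext (pinf_field p :: 'a set)"
begin

text \<open>Generators of \<open>F\<close> over its p-th powers also generate it over the larger
  field \<open>E\<close>.\<close>

lemma Ann_relder_eq:
  fixes F E :: "'a set"
  assumes F: "is_subfield F" "pow_field p i \<subseteq> F"
    and E: "is_subfield E" "E \<subseteq> F" "(\<lambda>x. x ^ p) ` F \<subseteq> E"
  shows "Ann F (relder F E) = E"
proof -
  obtain S where S: "finite S" "S \<subseteq> F" "gen_field ((\<lambda>x. x ^ p) ` F \<union> S) = F"
    using finite_generation_over_pth_powers[OF p K F] by blast
  have "gen_field (E \<union> S) \<subseteq> F" using F E S by (intro gen_field_least) auto
  moreover have "gen_field ((\<lambda>x. x ^ p) ` F \<union> S) \<subseteq> gen_field (E \<union> S)"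
    using E by (intro gen_field_mono) auto
  ultimately have "F = gen_field (E \<union> S)" using S by auto
  from Ann_relder[OF p E(1,2) this E(3) S(1)] show ?thesis .
qed

lemma p_lie_correspondence:
  fixes F :: "'a set"
  assumes F: "is_subfield F" "pow_field p i \<subseteq> F" and L: "p_lie p F L"
  shows "relder F (Ann F L) = L"
    and "\<exists>e. has_dim (\<lambda>c D x. c * D x) F L e \<and> has_dim (*) (Ann F L) F (p ^ e)"
proof -
  obtain S where "finite S" "S \<subseteq> F" "gen_field ((\<lambda>x. x ^ p) ` F \<union> S) = F"
    using finite_generation_over_pth_powers[OF p K F] by blast
  then show "relder F (Ann F L) = L"
    "\<exists>e. has_dim (\<lambda>c D x. c * D x) F L e \<and> has_dim (*) (Ann F L) F (p ^ e)"
    using jacobson_exponent_one[OF p F(1) L, of S] by (simp_all only: order_refl simp_thms)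
qed

lemma Ann_power_tower:
  fixes W :: "nat \<Rightarrow> 'a set"
  assumes W: "power_tower p W"
  shows "Ann (W i) (relder (W i) (W (Suc i))) = W (Suc i)"
  by (rule Ann_relder_eq[OF power_tower_subfield[OF W] power_tower_pow_field[OF W]
        power_tower_subfield[OF W] power_tower_antimono[OF W]])
     (use power_tower_pth_power[OF W] in auto)

lemma annseq_to_jac:
  fixes W :: "nat \<Rightarrow> 'a set"
  assumes W: "power_tower p W"
  shows "annseq (to_jac W) = W"
proof
  fix i show "annseq (to_jac W) i = W i"
    by (induction i) (simp_all add: power_tower_0[OF W] Ann_power_tower[OF W] to_jac_def)
qed

text \<open>The intersection condition mirrors the compositum: a derivation that kills both
  \<open>W (Suc i)\<close> and \<open>pow_field p i\<close> kills the field \<open>W i\<close> they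
  generate.\<close>

lemma jacobson_seq_to_jac:
  fixes W :: "nat \<Rightarrow> 'a set"
  assumes W: "power_tower p W"
  shows "jacobson_seq p (to_jac W)"
  unfolding jacobson_seq_def
proof (intro conjI allI impI)
  show "to_jac W 0 = {\<lambda>_. 0}" by (simp add: to_jac_def)
  have p_lie: "p_lie p (W i) (to_jac W (Suc i))" for i
    using p_lie_relder[OF p power_tower_subfield[OF W]] by (simp add: to_jac_def)
  show "p_lie p UNIV (to_jac W 1)" using p_lie[of 0] by (simp add: power_tower_0[OF W])
  fix i
  show "p_lie p (annseq (to_jac W) i) (to_jac W (Suc i))"
    using p_lie by (simp add: annseq_to_jac[OF W])
  have "D = (\<lambda>_. 0)" if D: "D \<in> to_jac W (Suc i)" "D \<in> relder (W i) (pow_field p i)" for D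
  proof
    fix x
    have der: "D \<in> der (W i)" using D by (simp add: relder_def)
    show "D x = 0"
    proof (cases "x \<in> W i")
      case True
      then have x: "x \<in> gen_field (W (Suc i) \<union> pow_field p i)"
        using power_tower_compositum[OF W, of i "Suc i"] by simp
      show ?thesis
        by (rule der_eq_0_gen_field[OF power_tower_subfield[OF W] der _ _ x])
           (use D power_tower_antimono[OF W, of i "Suc i"] power_tower_pow_field[OF W, of i]
            in \<open>auto simp: to_jac_def relder_def\<close>)
    qed (rule der_outside[OF der])
  qed
  moreover have "(\<lambda>_. 0) \<in> to_jac W (Suc i)" using p_lie_0[OF p_lie] .
  moreover have "(\<lambda>_. 0) \<in> relder (W i) (pow_field p i)"
    using p_lie_0[OF p_lie_relder[OF p power_tower_subfield[OF W]]] .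
  ultimately show "to_jac W (Suc i) \<inter> relder (annseq (to_jac W) i) (pow_field p i) = {\<lambda>_. 0}"
    unfolding annseq_to_jac[OF W] by blast
qed

lemma to_jac_annseq:
  fixes F :: "nat \<Rightarrow> ('a \<Rightarrow> 'a) set"
  assumes F: "jacobson_seq p F"
  shows "to_jac (annseq F) = F"
proof
  fix i show "to_jac (annseq F) i = F i"
  proof (cases i)
    case 0
    then show ?thesis using F by (simp add: to_jac_def jacobson_seq_def)
  next
    case (Suc j)
    then show ?thesis
      using p_lie_correspondence(1)[OF annseq_subfield[OF F] pow_field_subset_annseq[OF F]
          jacobson_seq_p_lie[OF F], of j]
      by (simp add: to_jac_def)
  qed
qed

lemma power_tower_annseq:
  fixes F :: "nat \<Rightarrow> ('a \<Rightarrow> 'a) set"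
  assumes F: "jacobson_seq p F"
  shows "power_tower p (annseq F)"
proof -
  note sub = annseq_subfield[OF F] and pow = pow_field_subset_annseq[OF F]
  have step: "annseq F j = gen_field (annseq F (Suc j) \<union> pow_field p j)" for j
  proof -
    let ?E = "gen_field (annseq F (Suc j) \<union> pow_field p j)"
    have E: "annseq F (Suc j) \<subseteq> ?E" "pow_field p j \<subseteq> ?E"
      using gen_field_superset[of "annseq F (Suc j) \<union> pow_field p j"] by auto
    have "?E \<subseteq> annseq F j"
      using annseq_antimono_Suc pow sub by (intro gen_field_least) auto
    moreover have "(\<lambda>x. x ^ p) ` annseq F j \<subseteq> ?E"
      using annseq_pth_power[OF F] E by blast
    ultimately have "Ann (annseq F j) (relder (annseq F j) ?E) = ?E"
      by (intro Ann_relder_eq[OF sub pow is_subfield_gen_field])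
    moreover have "relder (annseq F j) ?E = {\<lambda>_. 0}"
    proof
      have "relder (annseq F j) ?E \<subseteq> relder (annseq F j) (annseq F (Suc j))"
        "relder (annseq F j) ?E \<subseteq> relder (annseq F j) (pow_field p j)"
        using E by (auto simp: relder_def)
      moreover have "relder (annseq F j) (annseq F (Suc j)) = F (Suc j)"
        using p_lie_correspondence(1)[OF sub pow jacobson_seq_p_lie[OF F]] by simp
      ultimately show "relder (annseq F j) ?E \<subseteq> {\<lambda>_. 0}"
        using jacobson_seq_disjoint[OF F, of j] by blast
      show "{\<lambda>_. 0} \<subseteq> relder (annseq F j) ?E"
        using p_lie_0[OF p_lie_relder[OF p sub]] by simp
    qed
    ultimately show ?thesis by (simp add: Ann_zero)
  qed
  \<comment> \<open>Induction on the distance \<open>k\<close> with \<open>j\<close> free: the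
    hypothesis at \<open>Suc j\<close> is inserted into the single step at \<open>j\<close>, where
    the smaller \<open>pow_field p (Suc j)\<close> is absorbed by
    \<open>pow_field p j\<close>.\<close>
  have "annseq F j = gen_field (annseq F (j + k) \<union> pow_field p j)" for j k
  proof (induction k arbitrary: j)
    case 0
    have "annseq F j \<union> pow_field p j = annseq F j" using pow by blast
    moreover have "gen_field (annseq F j) = annseq F j"
      using gen_field_least[OF sub order_refl, of j] gen_field_superset[of "annseq F j"] by blast
    ultimately show ?case by simp
  next
    case (Suc k)
    let ?A = "annseq F (j + Suc k)"
    have "annseq F (Suc j) = gen_field (?A \<union> pow_field p (Suc j))"
      using Suc[of "Suc j"] by (simp only: add_Suc_shift)
    then have "annseq F j = gen_field (gen_field (?A \<union> pow_field p (Suc j)) \<union> pow_field p j)"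
      by (subst step) (simp only:)
    also have "\<dots> = gen_field (?A \<union> (pow_field p (Suc j) \<union> pow_field p j))"
      unfolding gen_field_gen_field by (simp add: Un_assoc)
    also have "pow_field p (Suc j) \<union> pow_field p j = (pow_field p j :: 'a set)"
      using pow_field_antimono[of j "Suc j" p] by auto
    finally show ?case .
  qed
  then have "annseq F j = gen_field (annseq F i \<union> pow_field p j)" if "j \<le> i" for i j
    using that by (metis le_add_diff_inverse)
  then show ?thesis using sub unfolding power_tower_def compositum_def by blast
qed

text \<open>The annihilator of \<open>to_jac W m\<close> is \<open>W m\<close> again, so one dual
  basis supplies both the dimension of the p-Lie algebra and the degree.\<close>

lemma dimension_formula:
  fixes W :: "nat \<Rightarrow> 'a set"
  assumes W: "power_tower p W" and m: "m \<ge> 1"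
  shows "\<exists>e. has_dim (\<lambda>c D x. c * D x) (W (m - 1)) (to_jac W m) e \<and>
              has_dim (*) (W m) (W (m - 1)) (p ^ e)"
proof -
  obtain i where i: "m = Suc i" using m by (cases m) auto
  have "p_lie p (W i) (to_jac W m)"
    using p_lie_relder[OF p power_tower_subfield[OF W]] by (simp add: to_jac_def i)
  from p_lie_correspondence(2)[OF power_tower_subfield[OF W] power_tower_pow_field[OF W] this]
  show ?thesis using Ann_power_tower[OF W, of i] by (simp add: to_jac_def i)
qed

end

end

theorem mainTheorem4:
  fixes p :: nat
  assumes "prime p"
    and "CHAR('a::field) = p"
    and "fin_gen_ext (pinf_field p :: 'a set)"
  shows "bij_betw (to_jac :: (nat \<Rightarrow> 'a set) \<Rightarrow> _) {W. power_tower p W} {F. jacobson_seq p F}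
    \<and> (\<forall>W :: nat \<Rightarrow> 'a set. power_tower p W \<longrightarrow> to_tower (to_jac W) = W)
    \<and> (\<forall>F :: nat \<Rightarrow> ('a \<Rightarrow> 'a) set. jacobson_seq p F \<longrightarrow> to_jac (to_tower F) = F)
    \<and> (\<forall>n. bij_betw (to_jac :: (nat \<Rightarrow> 'a set) \<Rightarrow> _)
             {W. power_tower p W \<and> tower_len_le W n} {F. jacobson_seq p F \<and> jac_len_le F n})
    \<and> (\<forall>(W :: nat \<Rightarrow> 'a set) m. power_tower p W \<and> m \<ge> 1 \<longrightarrow>
         (\<exists>e. has_dim (\<lambda>c D x. c * D x) (W (m - 1)) (to_jac W m) e \<and>
              has_dim (*) (W m) (W (m - 1)) (p ^ e)))"
proof (intro conjI allI impI)
  note inverse = annseq_to_jac[OF assms] to_jac_annseq[OF assms]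
    jacobson_seq_to_jac[OF assms] power_tower_annseq[OF assms]
  show "bij_betw (to_jac :: (nat \<Rightarrow> 'a set) \<Rightarrow> _) {W. power_tower p W} {F. jacobson_seq p F}"
    by (rule bij_betw_byWitness[where f' = annseq]) (simp_all add: inverse image_subset_iff)
  show "bij_betw (to_jac :: (nat \<Rightarrow> 'a set) \<Rightarrow> _)
      {W. power_tower p W \<and> tower_len_le W n} {F. jacobson_seq p F \<and> jac_len_le F n}" for n
    by (rule bij_betw_byWitness[where f' = annseq])
       (simp_all add: inverse image_subset_iff jac_len_le_to_jac[of p] tower_len_le_annseq)
  show "to_tower (to_jac W) = W" if "power_tower p W" for W :: "nat \<Rightarrow> 'a set"
    using that by (simp add: to_tower_def inverse)
  show "to_jac (to_tower F) = F" if "jacobson_seq p F" for F :: "nat \<Rightarrow> ('a \<Rightarrow> 'a) set"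
    using that by (simp add: to_tower_def inverse)
  fix W :: "nat \<Rightarrow> 'a set" and m :: nat
  assume "power_tower p W \<and> m \<ge> 1"
  then show "\<exists>e. has_dim (\<lambda>c D x. c * D x) (W (m - 1)) (to_jac W m) e \<and>
      has_dim (*) (W m) (W (m - 1)) (p ^ e)"
    by (elim conjE) (rule dimension_formula[OF assms])
qed

end
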